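(* Let $\{d_n\}_{n\ge1}$ be a sequence of complex numbers that is bounded by a multiple of $n^{\tau}$ for any $\tau>0$, let $\mathfrak d=\sum_{n\ge1}d_n\delta_n$, and let $r>\frac12$. Suppose that $L(s,\mathfrak d)$ is holomorphic and bounded by a polynomial on the strip $\{r\le\Re(s)\le1+\epsilon\}$ for some $\epsilon>0$. Then for any $\phi\in\mathcal H^\infty$, any $T\in\mathbb R$ and any $a>0$, $$\mu_{\mathfrak d,\phi}(b_Ta)=\langle\mu(b_Ta)\mathfrak d,\phi\rangle=\frac1{2\pi}\int_{-\infty}^{\infty} L(r+s_1i,\mathfrak d)\,\mathcal M\{\phi(x)e^{-2\pi iTx}\}(r+s_1i)\,a^{\frac12-r-s_1i}\,ds_1 .$$
   Context: $\mathbb R^+=(0,\infty)$. $G$ is the $ax+b$ group, with elements $ab_t=b_{a^{-1}t}a$ ($a\in\mathbb R^+$, $t\in\mathbb R$) and product $ab_t\,a'b_{t'}=aa'\,b_{a't+t'}$. $\mu$ is the unitary representation of $G$ on $\mathcal H=L^2(\mathbb R^+)$ given by $\mu(a)f(x)=a^{-1/2}f(a^{-1}x)$, $\mu(b_t)f(x)=e^{-2\pi itx}f(x)$; its contragredient $\mu^*$ on $L^2(\mathbb R^+)$ is $\mu^*(a)f(x)=a^{-1/2}f(a^{-1}x)$, $\mu^*(b_t)f(x)=e^{2\pi itx}f(x)$. $\mathcal H^\infty=\{f\in C^\infty(\mathbb R^+): x^m f^{(n)}\in L^2(\mathbb R^+)\ \forall m\ge n\ge0\}$ is the space of smooth vectors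 of $\mu$ (equal, as a space of functions, to that of $\mu^*$). $\delta_n$ is the Dirac distribution at $n$; pairings are bilinear, $\langle\mathfrak d,f\rangle=\sum_n d_nf(n)$, and $\mu_{\mathfrak d,\phi}(g)=\langle\mu(g)\mathfrak d,\phi\rangle:=\langle\mathfrak d,\mu^*(g^{-1})\phi\rangle$. The Mellin transform is $\mathcal Mf(s)=\int_0^\infty f(x)x^s\frac{dx}{x}$ (absolutely convergent for $f\in\mathcal H^\infty$, $\Re s>\frac12$). $L(s,\mathfrak d)=\sum_{n\ge1}d_nn^{-s}$ for $\Re s>1$; "holomorphic on the strip" means that $L(s,\mathfrak d)$ continues analytically to an open set containing the strip, and "bounded by a polynomial" means $|L(s,\mathfrak d)|\le C(1+|s|)^N$ on the strip for some $C,N$. *)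

theory Defs
  imports "HOL-Analysis.Analysis" "HOL-Algebra.Group"
begin

section \<open>The ax+b group and the contragredient representation\<close>

(* The pair (a, t) stands for the element  a b_t. *)
definition axb :: "(real \<times> real) monoid" where
  "axb = \<lparr>carrier = {0<..} \<times> UNIV,
          mult = (\<lambda>(a, t) (a', t'). (a * a', a' * t + t')),
          one = (1, 0)\<rparr>"

definition dil :: "real \<Rightarrow> real \<times> real" where
  "dil a = (a, 0)"

definition transl :: "real \<Rightarrow> real \<times> real" where
  "transl t = (1, t)"

lemma group_axb: "group axb"
proof (rule groupI)
  fix x assume "x \<in> carrier axb"
  then show "\<exists>y\<in>carrier axb. y \<otimes>\<^bsub>axb\<^esub> x = \<one>\<^bsub>axb\<^esub>"
    by (intro bexI[of _ "(1 / fst x, - snd x / fst x)"]) (auto simp: axb_def)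
qed (auto simp: axb_def algebra_simps)

lemma dil_transl:
  "a > 0 \<Longrightarrow> dil a \<otimes>\<^bsub>axb\<^esub> transl t = transl (t / a) \<otimes>\<^bsub>axb\<^esub> dil a"
  by (simp add: axb_def dil_def transl_def)

(* Functions on the positive half-line are functions on all of real; only their values
   on {0<..} matter. *)

definition mu_star_dil :: "real \<Rightarrow> (real \<Rightarrow> complex) \<Rightarrow> real \<Rightarrow> complex" where
  "mu_star_dil a f = (\<lambda>x. of_real (a powr (-1/2)) * f (x / a))"

definition mu_star_transl :: "real \<Rightarrow> (real \<Rightarrow> complex) \<Rightarrow> real \<Rightarrow> complex" where
  "mu_star_transl t f = (\<lambda>x. exp (2 * of_real pi * \<i> * of_real t * of_real x) * f x)"

definition mu_star :: "real \<times> real \<Rightarrow> (real \<Rightarrow> complex) \<Rightarrow> real \<Rightarrow> complex" where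
  "mu_star g f = mu_star_dil (fst g) (mu_star_transl (snd g) f)"

lemma mu_star_mult:
  assumes "g \<in> carrier axb" "h \<in> carrier axb"
  shows "mu_star (g \<otimes>\<^bsub>axb\<^esub> h) f = mu_star g (mu_star h f)"
  using assms
  by (auto simp: axb_def mu_star_def mu_star_dil_def mu_star_transl_def fun_eq_iff
        powr_mult exp_add[symmetric] field_simps)

section \<open>Smooth vectors\<close>

definition L2_pos :: "(real \<Rightarrow> complex) set" where
  "L2_pos = {f. set_borel_measurable lborel {0<..} f \<and>
                set_integrable lborel {0<..} (\<lambda>x. (cmod (f x))\<^sup>2)}"

definition nth_deriv :: "nat \<Rightarrow> (real \<Rightarrow> complex) \<Rightarrow> real \<Rightarrow> complex" where
  "nth_deriv n = ((\<lambda>f x. vector_derivative f (at x)) ^^ n)"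

definition smooth_pos :: "(real \<Rightarrow> complex) set" where
  "smooth_pos = {f. \<forall>n. \<forall>x>0. nth_deriv n f differentiable (at x)}"

definition H_infty :: "(real \<Rightarrow> complex) set" where
  "H_infty = {f \<in> smooth_pos.
     \<forall>m n. n \<le> m \<longrightarrow> (\<lambda>x. of_real (x ^ m) * nth_deriv n f x) \<in> L2_pos}"

section \<open>Distributions and matrix coefficients\<close>

type_synonym distr = "(real \<Rightarrow> complex) \<Rightarrow> complex"

definition dirac :: "real \<Rightarrow> distr" where
  "dirac x f = f x"

definition delta_series :: "(nat \<Rightarrow> complex) \<Rightarrow> distr" where
  "delta_series d f = (\<Sum>\<^sub>\<infinity>n\<in>{1..}. d n * dirac (real n) f)"

(* The action of mu on distributions, defined by duality from mu_star. *)
definition mu_distr :: "real \<times> real \<Rightarrow> distr \<Rightarrow> distr" where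
  "mu_distr g D = (\<lambda>f. D (mu_star (inv\<^bsub>axb\<^esub> g) f))"

definition mu_coeff :: "distr \<Rightarrow> (real \<Rightarrow> complex) \<Rightarrow> real \<times> real \<Rightarrow> complex" where
  "mu_coeff D f g = mu_distr g D f"

section \<open>Mellin transform and Dirichlet series\<close>

definition mellin :: "(real \<Rightarrow> complex) \<Rightarrow> complex \<Rightarrow> complex" where
  "mellin f s = (LINT x:{0<..}|lborel. f x * of_real x powr s / of_real x)"

(* Meaningful for Re s > 1 only; analytic continuations are handled separately. *)
definition dirichlet :: "(nat \<Rightarrow> complex) \<Rightarrow> complex \<Rightarrow> complex" where
  "dirichlet d s = (\<Sum>\<^sub>\<infinity>n\<in>{1..}. d n * of_nat n powr (-s))"

(* L is the Dirichlet series of d, continued analytically to an open set containing S.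
   When S is a strip r \<le> Re s \<le> 1 + e with e > 0, this determines L on S, as S is connected
   and meets the half-plane of convergence in a set with interior (or is empty). *)
definition L_continued_to :: "(nat \<Rightarrow> complex) \<Rightarrow> (complex \<Rightarrow> complex) \<Rightarrow> complex set \<Rightarrow> bool" where
  "L_continued_to d L S \<longleftrightarrow>
     (\<forall>s. Re s > 1 \<longrightarrow> L s = dirichlet d s) \<and>
     (\<exists>U. open U \<and> S \<subseteq> U \<and> L holomorphic_on U)"

end

theory Submission
  imports Defs
    "HOL-Probability.Characteristic_Functions"
    "HOL-Probability.Sinc_Integral"
    "HOL-Complex_Analysis.Cauchy_Integral_Formula"
    "HOL-Real_Asymp.Real_Asymp"
begin

text \<open>
  Put \<open>\<psi> x = \<phi> x * exp (- 2 * pi * \<i> * T * x)\<close>. Letting \<open>g = transl T \<otimes> dil a\<close> act on the distribution turns the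
  matrix coefficient into the sum of \<open>d n * \<psi> (a * n)\<close> over \<open>n \<ge> 1\<close>, times the square root of \<open>a\<close>. Mellin
  inversion writes \<open>\<psi> (a * n)\<close> as an integral of the Mellin transform of \<open>\<psi>\<close> against \<open>(a * n) powr (- s)\<close> over a
  vertical line. On a line with real part greater than 1 the Dirichlet series converges absolutely, the sum over \<open>n\<close>
  can be taken inside the integral, and the formula comes out with this line in place of the line through \<open>r\<close>
  (\<open>dirichlet_laplace_pairing\<close>). The Mellin transform of a smooth vector decays faster than any power of \<open>s\<close> on
  vertical strips to the right of 1/2, which outweighs the polynomial growth of \<open>L\<close> (\<open>continued_L_laplace_decay\<close>), so
  Cauchy's theorem moves the line to real part \<open>r\<close> (\<open>integral_vertical_line_shift\<close>).

  The analysis is done in the coordinate \<open>y = ln x\<close>. There the Mellin transform becomes a two-sided Laplace transform,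
  the operator \<open>x\<close> times \<open>d/dx\<close> becomes differentiation, and smooth vectors become the class \<open>log_smooth\<close>, which is
  closed under differentiation. Differentiating multiplies the transform by \<open>- s\<close>, which gives the rapid
  decay (\<open>laplace_rapid_decay\<close>). Inversion is Fourier inversion for a bounded, continuous, integrable function with
  integrable transform, proved by Gaussian regularisation (\<open>fourier_inversion_at_0\<close>, \<open>laplace_inversion\<close>).
\<close>

section \<open>Integrals over the line\<close>

lemma log_substitution:
  fixes f :: "real \<Rightarrow> 'a::euclidean_space"
  assumes meas: "set_borel_measurable lborel {0<..} f"
  shows "set_integrable lborel {0<..} f \<longleftrightarrow> integrable lborel (\<lambda>y. exp y *\<^sub>R f (exp y))"
    and "(LINT x:{0<..}|lborel. f x) = (LINT y|lborel. exp y *\<^sub>R f (exp y))"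
proof -
  have img: "exp ` (UNIV :: real set) = {0<..}"
    by (auto simp: image_iff) (metis exp_ln)
  have [measurable]: "(\<lambda>x. indicator {0<..} x *\<^sub>R f x) \<in> borel_measurable borel"
    using meas by (simp add: set_borel_measurable_def)
  have "(\<lambda>y. exp y *\<^sub>R (indicator {0<..} (exp y) *\<^sub>R f (exp y))) \<in> borel_measurable borel"
    by measurable
  then have m2: "(\<lambda>y. exp y *\<^sub>R f (exp y)) \<in> borel_measurable lborel"
    by simp
  have *: "((\<lambda>x. \<bar>exp x\<bar> *\<^sub>R f (exp x)) absolutely_integrable_on UNIV \<and> integral UNIV (\<lambda>x. \<bar>exp x\<bar> *\<^sub>R f (exp x)) = b)
          \<longleftrightarrow> (f absolutely_integrable_on exp ` UNIV \<and> integral (exp ` UNIV) f = b)" for b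
    by (rule has_absolute_integral_change_of_variables_real)
       (auto intro!: derivative_eq_intros inj_onI)
  have i1: "f absolutely_integrable_on {0<..} \<longleftrightarrow> set_integrable lborel {0<..} f"
    unfolding set_integrable_def by (rule integrable_completion) (use meas in \<open>simp add: set_borel_measurable_def\<close>)
  have i2: "(\<lambda>x. exp x *\<^sub>R f (exp x)) absolutely_integrable_on UNIV \<longleftrightarrow> integrable lborel (\<lambda>y. exp y *\<^sub>R f (exp y))"
    using integrable_completion[OF m2] by (simp add: set_integrable_def)
  show eq: "set_integrable lborel {0<..} f \<longleftrightarrow> integrable lborel (\<lambda>y. exp y *\<^sub>R f (exp y))"
    using * i1 i2 by (auto simp: img)
  show "(LINT x:{0<..}|lborel. f x) = (LINT y|lborel. exp y *\<^sub>R f (exp y))"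
  proof (cases "set_integrable lborel {0<..} f")
    case True
    then have "f absolutely_integrable_on {0<..}" using i1 by simp
    then have "integral UNIV (\<lambda>x. exp x *\<^sub>R f (exp x)) = integral {0<..} f"
      using *[of "integral {0<..} f"] by (simp add: img)
    moreover have "integral {0<..} f = (LINT x:{0<..}|lborel. f x)"
      using True by (intro set_borel_integral_eq_integral(2)[symmetric])
    moreover have "integral UNIV (\<lambda>x. exp x *\<^sub>R f (exp x)) = (LINT y|lborel. exp y *\<^sub>R f (exp y))"
      using True eq by (intro integral_lborel) auto
    ultimately show ?thesis by simp
  next
    case False
    then show ?thesis using eq
      by (simp add: set_integrable_def set_lebesgue_integral_def not_integrable_integral_eq)
  qed
qed

lemma integrable_exp_half_lines:
  fixes c :: real
  assumes "c > 0"
  shows "integrable lborel (\<lambda>y. indicator {0<..} y * exp (- c * y))"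
    and "integrable lborel (\<lambda>y. indicator {..<0} y * exp (c * y))"
proof -
  show *: "integrable lborel (\<lambda>y. indicator {0<..} y * exp (- c * y))"
    using integrable_I0i_exp_mscale[OF assms] by (simp add: set_integrable_def mult.commute)
  show "integrable lborel (\<lambda>y. indicator {..<0} y * exp (c * y))"
    using lborel_integrable_real_affine[OF *, of "-1" 0]
    by (rule Bochner_Integration.integrable_cong[THEN iffD1, rotated 2]) (auto simp: indicator_def)
qed

lemma norm_set_integral_le:
  fixes f :: "real \<Rightarrow> complex"
  assumes f: "integrable lborel f" and A: "A \<in> sets borel"
  shows "norm (LINT x:A|lborel. f x) \<le> (LINT x|lborel. norm (f x))"
  unfolding set_lebesgue_integral_def
proof (rule order_trans[OF integral_norm_bound], rule integral_mono)
  show "integrable lborel (\<lambda>x. norm (indicator A x *\<^sub>R f x))"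
    using f A by (intro integrable_norm integrable_mult_indicator) auto
qed (use f in \<open>auto simp: indicator_def\<close>)

lemma integral_exhaustion_limit:
  fixes f :: "real \<Rightarrow> 'a::{banach, second_countable_topology}"
  assumes f: "integrable lborel f"
  shows "(\<lambda>n. LINT t:{c - real n..c + real n}|lborel. f t) \<longlonglongrightarrow> (LINT t|lborel. f t)"
  unfolding set_lebesgue_integral_def
proof (rule integral_dominated_convergence[where w = "\<lambda>x. norm (f x)"])
  show "AE x in lborel. (\<lambda>n. indicat_real {c - real n..c + real n} x *\<^sub>R f x) \<longlonglongrightarrow> f x"
  proof (intro AE_I2 tendsto_eventually)
    fix x :: real
    obtain N where N: "real N \<ge> \<bar>x - c\<bar>" using real_arch_simple by blast
    show "\<forall>\<^sub>F n in sequentially. indicat_real {c - real n..c + real n} x *\<^sub>R f x = f x"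
      using eventually_ge_at_top[of N]
    proof eventually_elim
      case (elim n)
      then have "real n \<ge> real N" by simp
      with N show ?case by (auto simp: indicator_def)
    qed
  qed
  show "(\<lambda>x. indicat_real {c - real n..c + real n} x *\<^sub>R f x) \<in> borel_measurable lborel" for n
    using f by (intro borel_measurable_scaleR) auto
qed (use f in \<open>auto split: split_indicator\<close>)

text \<open>
  There are no boundary terms, because an integrable function with integrable derivative tends to 0 at both
  ends. The proof avoids the limits of \<open>k\<close>: integrals of \<open>k'\<close> over long windows approximate the whole integral,
  and after averaging over the position of the window they become differences of integrals of \<open>k\<close> over unit
  intervals far out, which vanish in the limit.
\<close>

lemma integral_derivative_eq_0:
  fixes k k' :: "real \<Rightarrow> complex"
  assumes der: "\<And>y. (k has_vector_derivative k' y) (at y)"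
    and k: "integrable lborel k" and k': "integrable lborel k'"
  shows "(LINT y|lborel. k' y) = 0"
proof -
  have cont: "continuous_on A k" for A
    using der has_vector_derivative_continuous by (blast intro: continuous_at_imp_continuous_on)
  \<comment> \<open>The integral of \<open>k'\<close> over a window of width \<open>2 n\<close> centred at \<open>v\<close>; it is averaged below over \<open>v\<close> in
    \<open>{0..1}\<close>, because integrability of \<open>k\<close> makes averages of \<open>k (v + n)\<close> small, but not directly the single values.\<close>
  define D where "D n v = k (v + real n) - k (v - real n)" for n v
  have D_eq: "D n v = (LINT y:{v - real n..v + real n}|lborel. k' y)" for n v
  proof -
    have "(k' has_integral D n v) {v - real n..v + real n}"
      unfolding D_def by (rule fundamental_theorem_of_calculus) (auto intro: has_vector_derivative_at_within der)
    moreover have "set_integrable lborel {v - real n..v + real n} k'"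
      using k' by (rule set_integrable_subset[where A=UNIV, unfolded set_integrable_def indicator_UNIV scaleR_one, folded set_integrable_def]) auto
    ultimately show ?thesis
      using set_borel_integral_eq_integral(2) by (metis integral_unique)
  qed
  have bound: "norm (D n v) \<le> (LINT y|lborel. norm (k' y))" for n v
    unfolding D_eq by (rule norm_set_integral_le[OF k']) simp
  have lim: "(\<lambda>n. D n v) \<longlonglongrightarrow> (LINT y|lborel. k' y)" for v
    unfolding D_eq by (rule integral_exhaustion_limit[OF k'])
  have "(\<lambda>n. LINT v:{0..1}|lborel. D n v) \<longlonglongrightarrow> (LINT v:{0..1::real}|lborel. (LINT y|lborel. k' y))"
    unfolding set_lebesgue_integral_def
  proof (rule integral_dominated_convergence[where w = "\<lambda>v. indicator {0..1::real} v * (LINT y|lborel. norm (k' y))"])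
    show "(\<lambda>v. indicat_real {0..1} v *\<^sub>R D n v) \<in> borel_measurable lborel" for n
      unfolding D_def using k
      by (auto intro!: borel_measurable_continuous_onI continuous_intros continuous_on_compose2[OF cont] borel_measurable_scaleR)
    show "integrable lborel (\<lambda>v. indicator {0..1::real} v * (LINT y|lborel. norm (k' y)))"
      by (intro integrable_mult_left integrable_real_indicator) auto
  qed (use lim bound in \<open>auto split: split_indicator\<close>)
  moreover have "(\<lambda>n. LINT v:{0..1}|lborel. D n v) \<longlonglongrightarrow> 0"
  proof -
    have sh: "(LINT v:{0..1}|lborel. k (v + c)) = (LINT y:{c..c+1}|lborel. k y)" for c
      unfolding set_lebesgue_integral_def
      by (subst lborel_integral_real_affine[where c=1 and t=c and f="\<lambda>y. indicat_real {c..c + 1} y *\<^sub>R k y"])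
         (auto intro!: Bochner_Integration.integral_cong simp: indicator_def add.commute)
    have "(LINT v:{0..1}|lborel. D n v) = (LINT y:{real n..real n+1}|lborel. k y) - (LINT y:{-real n..-real n+1}|lborel. k y)" for n
    proof -
      have "(LINT v:{0..1}|lborel. k (v + real n) - k (v + - real n))
          = (LINT y:{real n..real n+1}|lborel. k y) - (LINT y:{-real n..-real n+1}|lborel. k y)"
        unfolding sh[symmetric]
        by (rule set_integral_diff(2))
           (auto intro!: borel_integrable_compact continuous_intros continuous_on_compose2[OF cont] simp: set_integrable_def)
      then show ?thesis by (simp add: D_def)
    qed
    moreover have "(\<lambda>n. LINT y:{c n..c n+1}|lborel. k y) \<longlonglongrightarrow> 0" if c: "\<And>n. \<bar>c n\<bar> = real n" for c
    proof -
      have "(\<lambda>n. LINT y|lborel. indicat_real {c n..c n + 1} y *\<^sub>R k y) \<longlonglongrightarrow> (LINT y|(lborel::real measure). 0)"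
      proof (rule integral_dominated_convergence[where w="\<lambda>y. norm (k y)"])
        show "AE y in lborel. (\<lambda>n. indicat_real {c n..c n + 1} y *\<^sub>R k y) \<longlonglongrightarrow> 0"
        proof (intro AE_I2 tendsto_eventually)
          fix y :: real
          obtain N where N: "real N \<ge> \<bar>y\<bar> + 2" using real_arch_simple by blast
          show "\<forall>\<^sub>F n in sequentially. indicat_real {c n..c n + 1} y *\<^sub>R k y = 0"
            using eventually_ge_at_top[of N]
          proof eventually_elim
            case (elim n)
            then have "real n \<ge> real N" by simp
            then have "\<bar>c n\<bar> \<ge> \<bar>y\<bar> + 2" using N c[of n] by simp
            then show ?case by (auto simp: indicator_def)
          qed
        qed
        show "(\<lambda>y. indicat_real {c n..c n + 1} y *\<^sub>R k y) \<in> borel_measurable lborel" for n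
          using k by (intro borel_measurable_scaleR) auto
      qed (use k in \<open>auto split: split_indicator\<close>)
      then show ?thesis by (simp add: set_lebesgue_integral_def)
    qed
    from tendsto_diff[OF this[of real] this[of "\<lambda>n. - real n"]]
    have "(\<lambda>n. (LINT y:{real n..real n+1}|lborel. k y) - (LINT y:{-real n..-real n+1}|lborel. k y)) \<longlonglongrightarrow> 0"
      by simp
    ultimately show ?thesis by simp
  qed
  ultimately show ?thesis
    using LIMSEQ_unique by (fastforce simp: set_lebesgue_integral_def)
qed

lemma integrable_inverse_square_decay:
  fixes f :: "real \<Rightarrow> complex"
  assumes cont: "continuous_on UNIV f" and bd: "\<And>t. norm (f t) \<le> B / (1 + t\<^sup>2)"
  shows "integrable lborel f"
proof (rule Bochner_Integration.integrable_bound)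
  show "integrable lborel (\<lambda>t. B * inverse (1 + t\<^sup>2))"
    using integrable_inverse_1_plus_square by (simp add: set_integrable_def)
  show "AE t in lborel. norm (f t) \<le> norm (B * inverse (1 + t\<^sup>2))"
    using order_trans[OF bd abs_ge_self] by (simp add: divide_inverse)
qed (use cont in \<open>auto intro: borel_measurable_continuous_onI\<close>)

section \<open>Smooth vectors in the logarithmic coordinate\<close>

text \<open>
  The smooth vectors in the coordinate \<open>y = ln x\<close>, where \<open>x\<close>-multiplied differentiation becomes plain
  differentiation. The weight \<open>exp ((2 * m + 1) * y)\<close> is \<open>x ^ (2 * m)\<close> times the Jacobian \<open>x\<close>: it says that \<open>x ^ m\<close> times
  the function is square integrable on the half-line. The definition is coinductive, so that
  all derivatives satisfy bounds of the same kind.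
\<close>

coinductive log_smooth :: "(real \<Rightarrow> complex) \<Rightarrow> bool" where
  log_smoothI: "\<lbrakk>\<And>y. (u has_vector_derivative v y) (at y);
     \<And>m::nat. integrable lborel (\<lambda>y. (cmod (u y))\<^sup>2 * exp ((2 * real m + 1) * y));
     log_smooth v\<rbrakk> \<Longrightarrow> log_smooth u"

lemma log_smooth_continuous: "log_smooth u \<Longrightarrow> continuous_on A u"
  by (erule log_smooth.cases) (blast intro: continuous_at_imp_continuous_on has_vector_derivative_continuous)

text \<open>
  The bound \<open>p * q \<le> p\<^sup>2 + q\<^sup>2\<close> replaces the Cauchy-Schwarz inequality. The condition \<open>\<sigma> > 1/2\<close> is what makes the
  complementary exponential square integrable towards minus infinity, that is, near \<open>x = 0\<close>.
\<close>

lemma log_smooth_integrable_cmod: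
  assumes u: "log_smooth u" and \<sigma>: "\<sigma> > 1/2"
  shows "integrable lborel (\<lambda>y. cmod (u y) * exp (\<sigma> * y))"
proof -
  define E where "E m y = (cmod (u y))\<^sup>2 * exp ((2 * real m + 1) * y)" for m :: nat and y :: real
  have E: "integrable lborel (E m)" for m
    using u unfolding E_def by cases auto
  have cont: "continuous_on UNIV u" by (rule log_smooth_continuous[OF u])
  obtain m :: nat where m: "real m > \<sigma>" using reals_Archimedean2 by blast
  \<comment> \<open>A weighted square on one side, and a pure exponential on the other: the exponential is integrable on
    the left half-line for \<open>l = 0\<close>, since \<open>\<sigma> > 1/2\<close>, and on the right half-line for \<open>l = m\<close>.\<close>
  have amgm: "cmod (u y) * exp (\<sigma> * y) \<le> E l y + exp ((2 * \<sigma> - 2 * real l - 1) * y)" for l y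
  proof -
    define p q where "p = cmod (u y) * exp ((real l + 1/2) * y)" and "q = exp ((\<sigma> - real l - 1/2) * y)"
    have "cmod (u y) * exp (\<sigma> * y) = p * q"
      by (simp add: p_def q_def mult.assoc flip: exp_add) (simp add: algebra_simps)
    also have "\<dots> \<le> p\<^sup>2 + q\<^sup>2"
    proof -
      have "0 \<le> p * q" by (simp add: p_def q_def)
      then show ?thesis using sum_squares_bound[of p q] by linarith
    qed
    also have "\<dots> = E l y + exp ((2 * \<sigma> - 2 * real l - 1) * y)"
    proof -
      have "(exp z)\<^sup>2 = exp (2 * z)" for z :: real
        by (simp add: power2_eq_square flip: exp_add)
      then show ?thesis
        by (simp add: p_def q_def E_def power_mult_distrib) (simp add: algebra_simps)
    qed
    finally show ?thesis .
  qed
  \<comment> \<open>The last summand covers the point 0, which neither open half-line contains.\<close>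
  let ?w = "\<lambda>y. E 0 y + E m y + indicator {..<0} y * exp ((2 * \<sigma> - 1) * y)
        + indicator {0<..} y * exp (- (2 * real m + 1 - 2 * \<sigma>) * y) + indicator {0} y * exp 0"
  have E0: "E l y \<ge> 0" for l y by (simp add: E_def)
  have le: "cmod (u y) * exp (\<sigma> * y) \<le> ?w y" for y
  proof (cases y "0::real" rule: linorder_cases)
    case less
    then show ?thesis using amgm[of y 0] E0[of m y] by simp
  next
    case equal
    then show ?thesis using amgm[of y 0] E0[of m y] by simp
  next
    case greater
    then show ?thesis using amgm[of y m] E0[of 0 y] by (simp add: algebra_simps)
  qed
  have "integrable lborel ?w"
    by (intro Bochner_Integration.integrable_add E integrable_exp_half_lines) (use m \<sigma> in auto)
  then show ?thesis
  proof (rule Bochner_Integration.integrable_bound)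
    show "(\<lambda>y. cmod (u y) * exp (\<sigma> * y)) \<in> borel_measurable lborel"
      by (auto intro!: borel_measurable_continuous_onI continuous_intros cont)
    show "AE y in lborel. norm (cmod (u y) * exp (\<sigma> * y)) \<le> norm (?w y)"
    proof (intro AE_I2)
      fix y show "norm (cmod (u y) * exp (\<sigma> * y)) \<le> norm (?w y)"
      proof -
        have "0 \<le> cmod (u y) * exp (\<sigma> * y)" by simp
        then show ?thesis using le[of y] unfolding real_norm_def by linarith
      qed
    qed
  qed
qed

lemma log_smooth_integrable:
  assumes u: "log_smooth u" and s: "Re s > 1/2"
  shows "integrable lborel (\<lambda>y. u y * exp (s * of_real y))"
proof (rule Bochner_Integration.integrable_bound[OF log_smooth_integrable_cmod[OF u s]])
  show "(\<lambda>y. u y * exp (s * of_real y)) \<in> borel_measurable lborel"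
    using log_smooth_continuous[OF u, of UNIV]
    by (auto intro!: borel_measurable_continuous_onI continuous_intros)
qed (auto simp: norm_mult)

text \<open>
  In the coordinate \<open>x\<close> this says that a smooth vector is of order \<open>x powr (- \<sigma>)\<close> for every \<open>\<sigma> > 1/2\<close>: the
  function \<open>u y * exp (\<sigma> * y)\<close> has an integrable derivative, hence bounded variation.
\<close>

lemma log_smooth_bounded:
  assumes u: "log_smooth u" and \<sigma>: "\<sigma> > 1/2"
  obtains B where "\<And>y. cmod (u y) * exp (\<sigma> * y) \<le> B"
proof -
  from u obtain v where v: "log_smooth v" and der: "\<And>y. (u has_vector_derivative v y) (at y)"
    by cases auto
  define s where "s = complex_of_real \<sigma>"
  define k k' where "k = (\<lambda>y. u y * exp (s * of_real y))"
    and "k' = (\<lambda>y. v y * exp (s * of_real y) + s * (u y * exp (s * of_real y)))"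
  have der: "(k has_vector_derivative k' y) (at y)" for y
    unfolding k_def k'_def by (rule derivative_eq_intros der has_vector_derivative_real_field refl | simp)+
  have k': "integrable lborel k'"
    unfolding k'_def using \<sigma> log_smooth_integrable[of _ s] u v by (auto simp: s_def)
  have sub: "norm (k b - k a) \<le> (LINT y|lborel. norm (k' y))" if "a \<le> b" for a b
  proof -
    have "(k' has_integral k b - k a) {a..b}"
      by (rule fundamental_theorem_of_calculus[OF that]) (auto intro: has_vector_derivative_at_within der)
    moreover have "set_integrable lborel {a..b} k'"
      using k' by (auto simp: set_integrable_def intro!: integrable_mult_indicator)
    ultimately have "k b - k a = (LINT y:{a..b}|lborel. k' y)"
      using set_borel_integral_eq_integral(2) by (metis integral_unique)
    also have "norm \<dots> \<le> (LINT y|lborel. norm (k' y))"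
      by (rule norm_set_integral_le[OF k']) simp
    finally show ?thesis .
  qed
  have "cmod (u y) * exp (\<sigma> * y) \<le> norm (k 0) + (LINT y|lborel. norm (k' y))" for y
  proof -
    have "cmod (u y) * exp (\<sigma> * y) = norm (k y)" by (simp add: k_def norm_mult s_def)
    also have "\<dots> \<le> norm (k 0) + norm (k y - k 0)" by norm
    also have "norm (k y - k 0) \<le> (LINT y|lborel. norm (k' y))"
      using sub[of 0 y] sub[of y 0] by (cases "y \<ge> 0") (auto simp: norm_minus_commute)
    finally show ?thesis by simp
  qed
  then show ?thesis using that by blast
qed

section \<open>The two-sided Laplace transform\<close>

text \<open>
  The two-sided Laplace transform, which is the Mellin transform in the coordinate \<open>y = ln x\<close>.
\<close>

definition laplace :: "(real \<Rightarrow> complex) \<Rightarrow> complex \<Rightarrow> complex" where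
  "laplace u s = (LINT y|lborel. u y * exp (s * of_real y))"

text \<open>
  One function dominates all these exponentials: the upper end of the interval of \<open>\<sigma>\<close> wins for
  \<open>y \<ge> 0\<close>, the lower end for \<open>y < 0\<close>.
\<close>

lemma exp_strip_le:
  fixes y :: real
  assumes "\<sigma>1 \<le> \<sigma>" "\<sigma> \<le> \<sigma>2"
  shows "exp (\<sigma> * y) \<le> exp (\<sigma>1 * y) + exp (\<sigma>2 * y)"
proof (cases "y \<ge> 0")
  case True
  then have "exp (\<sigma> * y) \<le> exp (\<sigma>2 * y)" using assms by (simp add: mult_right_mono)
  then show ?thesis using exp_ge_zero[of "\<sigma>1 * y"] by linarith
next
  case False
  then have "exp (\<sigma> * y) \<le> exp (\<sigma>1 * y)" using assms by (simp add: mult_right_mono_neg)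
  then show ?thesis using exp_ge_zero[of "\<sigma>2 * y"] by linarith
qed

text \<open>
  Integration by parts, without boundary terms by \<open>integral_derivative_eq_0\<close>.
\<close>

lemma laplace_deriv:
  assumes u: "log_smooth u" and v: "log_smooth v" and s: "Re s > 1/2"
    and der: "\<And>y. (u has_vector_derivative v y) (at y)"
  shows "laplace v s = - s * laplace u s"
proof -
  have iu: "integrable lborel (\<lambda>y. u y * exp (s * of_real y))"
    and iv: "integrable lborel (\<lambda>y. v y * exp (s * of_real y))"
    using log_smooth_integrable u v s by auto
  have "(LINT y|lborel. v y * exp (s * of_real y) + s * (u y * exp (s * of_real y))) = 0"
  proof (rule integral_derivative_eq_0[OF _ iu])
    show "((\<lambda>y. u y * exp (s * of_real y)) has_vector_derivative
           v y * exp (s * of_real y) + s * (u y * exp (s * of_real y))) (at y)" for y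
      by (rule derivative_eq_intros der has_vector_derivative_real_field refl | simp)+
  qed (use iu iv in auto)
  then show ?thesis
    using iu iv by (simp add: laplace_def eq_neg_iff_add_eq_0)
qed

lemma cmod_laplace_le:
  assumes u: "log_smooth u" and \<sigma>1: "\<sigma>1 > 1/2"
  obtains B where "\<And>s. \<sigma>1 \<le> Re s \<Longrightarrow> Re s \<le> \<sigma>2 \<Longrightarrow> cmod (laplace u s) \<le> B"
proof (cases "\<sigma>1 \<le> \<sigma>2")
  case True
  have i: "integrable lborel (\<lambda>y. cmod (u y) * exp (\<sigma>1 * y) + cmod (u y) * exp (\<sigma>2 * y))"
    using log_smooth_integrable_cmod[OF u] \<sigma>1 True by auto
  show ?thesis
  proof (rule that)
    fix s assume s: "\<sigma>1 \<le> Re s" "Re s \<le> \<sigma>2"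
    show "cmod (laplace u s) \<le> (LINT y|lborel. cmod (u y) * exp (\<sigma>1 * y) + cmod (u y) * exp (\<sigma>2 * y))"
      unfolding laplace_def
    proof (rule order_trans[OF integral_norm_bound], rule integral_mono[OF _ i])
      show "integrable lborel (\<lambda>y. norm (u y * exp (s * of_real y)))"
        using log_smooth_integrable[OF u, of s] s \<sigma>1 by auto
      fix y
      have "exp (Re s * y) \<le> exp (\<sigma>1 * y) + exp (\<sigma>2 * y)"
        using s by (rule exp_strip_le)
      then have "cmod (u y) * exp (Re s * y) \<le> cmod (u y) * (exp (\<sigma>1 * y) + exp (\<sigma>2 * y))"
        by (intro mult_left_mono) auto
      then show "norm (u y * exp (s * of_real y)) \<le> cmod (u y) * exp (\<sigma>1 * y) + cmod (u y) * exp (\<sigma>2 * y)"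
        by (simp add: norm_mult algebra_simps)
    qed
  qed
qed (use that in force)

text \<open>
  Each differentiation of \<open>u\<close> multiplies the transform by \<open>- s\<close>, and the transform of any derivative of \<open>u\<close> is
  bounded on vertical strips.
\<close>

lemma laplace_rapid_decay:
  assumes "log_smooth u" and \<sigma>1: "\<sigma>1 > 1/2"
  shows "\<exists>B. \<forall>s. \<sigma>1 \<le> Re s \<and> Re s \<le> \<sigma>2 \<longrightarrow> cmod (laplace u s) * cmod s ^ N \<le> B"
  using assms(1)
proof (induction N arbitrary: u)
  case 0
  then show ?case using cmod_laplace_le[OF _ \<sigma>1] by (metis mult.right_neutral power_0)
next
  case (Suc N)
  from \<open>log_smooth u\<close> obtain v where v: "log_smooth v" and der: "\<And>y. (u has_vector_derivative v y) (at y)"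
    by cases auto
  have "cmod (laplace u s) * cmod s ^ Suc N = cmod (laplace v s) * cmod s ^ N" if "\<sigma>1 \<le> Re s" for s
    using laplace_deriv[OF Suc.prems v _ der, of s] that \<sigma>1 by (simp add: norm_mult)
  then show ?case using Suc.IH[OF v] by (metis (no_types, lifting))
qed

text \<open>
  The transform is a locally uniform limit of integrals over compact intervals, which are holomorphic by
  differentiation under the integral sign.
\<close>

lemma laplace_holomorphic:
  assumes u: "log_smooth u"
  shows "laplace u holomorphic_on {s. Re s > 1/2}"
proof (rule holomorphic_uniform_sequence
    [where f = "\<lambda>n s. integral (cbox (- real n) (real n)) (\<lambda>y. u y * exp (s * of_real y))"])
  have cu: "continuous_on A u" for A by (rule log_smooth_continuous[OF u])
  show "open {s. Re s > 1/2}" by (rule open_halfspace_Re_gt)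
  show "(\<lambda>s. integral (cbox (- real n) (real n)) (\<lambda>y. u y * exp (s * of_real y))) holomorphic_on {s. Re s > 1/2}" for n
  proof (rule leibniz_rule_holomorphic[where fx = "\<lambda>s y. u y * (of_real y * exp (s * of_real y))"])
    show "((\<lambda>s. u y * exp (s * of_real y)) has_field_derivative u y * (of_real y * exp (s * of_real y)))
            (at s within {s. Re s > 1/2})" for s y
      by (auto intro!: derivative_eq_intros)
    show "(\<lambda>y. u y * exp (s * of_real y)) integrable_on cbox (- real n) (real n)" for s
      by (intro integrable_continuous continuous_intros cu)
    show "continuous_on ({s. Re s > 1/2} \<times> cbox (- real n) (real n)) (\<lambda>(s, y). u y * (of_real y * exp (s * of_real y)))"
      unfolding case_prod_unfold
      by (intro continuous_intros continuous_on_compose2[OF cu[of UNIV]]) auto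
    show "convex {s. Re s > 1/2}" by (rule convex_halfspace_Re_gt)
  qed
  fix z assume "z \<in> {s. Re s > 1/2}"
  then have z: "Re z > 1/2" by simp
  define r where "r = (Re z - 1/2) / 2"
  have r: "r > 0" "Re z - r > 1/2" using z by (auto simp: r_def field_simps)
  have strip: "Re z - r \<le> Re s" "Re s \<le> Re z + r" if "s \<in> cball z r" for s
    using that abs_Re_le_cmod[of "z - s"] by (auto simp: dist_norm abs_le_iff)
  \<comment> \<open>Dominates the integrand for every \<open>s\<close> in the disc, so that its tails bound the error uniformly.\<close>
  define w where "w y = cmod (u y) * (exp ((Re z - r) * y) + exp ((Re z + r) * y))" for y
  have w: "integrable lborel w"
    unfolding w_def distrib_left
    by (intro Bochner_Integration.integrable_add log_smooth_integrable_cmod[OF u]) (use r in auto)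
  let ?I = "\<lambda>n. {0 - real n..0 + real n}"
  have tail: "(\<lambda>n. (LINT y|lborel. w y) - (LINT y:?I n|lborel. w y)) \<longlonglongrightarrow> (LINT y|lborel. w y) - (LINT y|lborel. w y)"
    by (intro tendsto_diff tendsto_const integral_exhaustion_limit[OF w])
  have est: "cmod (integral (cbox (- real n) (real n)) (\<lambda>y. u y * exp (s * of_real y)) - laplace u s)
       \<le> (LINT y|lborel. w y) - (LINT y:?I n|lborel. w y)" if s: "s \<in> cball z r" for n s
  proof -
    let ?h = "\<lambda>y. u y * exp (s * of_real y)"
    have h: "integrable lborel ?h"
      using strip[OF s] r by (intro log_smooth_integrable[OF u]) auto
    have hI: "integrable lborel (\<lambda>y. indicator (?I n) y *\<^sub>R ?h y)"
      and wI: "integrable lborel (\<lambda>y. indicator (?I n) y *\<^sub>R w y)"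
      using h w by (intro integrable_mult_indicator; simp)+
    have "integral (cbox (- real n) (real n)) ?h = (LINT y:?I n|lborel. ?h y)"
      using hI by (subst set_borel_integral_eq_integral(2)) (auto simp: set_integrable_def)
    then have "integral (cbox (- real n) (real n)) ?h - laplace u s
        = (LINT y|lborel. indicator (?I n) y *\<^sub>R ?h y - ?h y)"
      using h hI by (simp add: laplace_def set_lebesgue_integral_def)
    also have "norm \<dots> \<le> (LINT y|lborel. w y - indicator (?I n) y *\<^sub>R w y)"
    proof (rule order_trans[OF integral_norm_bound], rule integral_mono)
      fix y
      have "cmod (?h y) \<le> w y"
        using exp_strip_le[OF strip[OF s], of y] by (simp add: w_def norm_mult mult_left_mono)
      then show "norm (indicator (?I n) y *\<^sub>R ?h y - ?h y) \<le> w y - indicator (?I n) y *\<^sub>R w y"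
        by (auto split: split_indicator)
    qed (use h hI w wI in \<open>auto simp del: real_scaleR_def\<close>)
    also have "\<dots> = (LINT y|lborel. w y) - (LINT y:?I n|lborel. w y)"
      unfolding set_lebesgue_integral_def by (rule Bochner_Integration.integral_diff[OF w wI])
    finally show ?thesis .
  qed
  have "uniform_limit (cball z r) (\<lambda>n s. integral (cbox (- real n) (real n)) (\<lambda>y. u y * exp (s * of_real y)))
      (laplace u) sequentially"
    unfolding uniform_limit_iff
  proof (intro allI impI)
    fix e :: real assume "e > 0"
    then have "\<forall>\<^sub>F n in sequentially. (LINT y|lborel. w y) - (LINT y:?I n|lborel. w y) < e"
      using order_tendstoD(2)[OF tail, of e] by simp
    then show "\<forall>\<^sub>F n in sequentially. \<forall>s\<in>cball z r.
        dist (integral (cbox (- real n) (real n)) (\<lambda>y. u y * exp (s * of_real y))) (laplace u s) < e"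
    proof eventually_elim
      case (elim n)
      show ?case
        unfolding dist_norm by (intro ballI le_less_trans[OF est elim])
    qed
  qed
  moreover have "cball z r \<subseteq> {s. Re s > 1/2}"
    using strip r by force
  ultimately show "\<exists>d>0. cball z d \<subseteq> {s. Re s > 1/2} \<and>
      uniform_limit (cball z d) (\<lambda>n s. integral (cbox (- real n) (real n)) (\<lambda>y. u y * exp (s * of_real y))) (laplace u) sequentially"
    using r(1) by blast
qed

lemma laplace_vertical_continuous:
  assumes "log_smooth u" "\<sigma> > 1/2"
  shows "continuous_on UNIV (\<lambda>t. laplace u (Complex \<sigma> t))"
  by (rule continuous_on_compose2[OF holomorphic_on_imp_continuous_on[OF laplace_holomorphic[OF assms(1)]]])
     (use assms in \<open>auto simp: Complex_eq intro!: continuous_intros\<close>)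

lemma one_plus_Im_square_le:
  assumes "Re s \<ge> 1/2"
  shows "1 + (Im s)\<^sup>2 \<le> 4 * (cmod s)\<^sup>2"
proof -
  have "(1/2)\<^sup>2 \<le> (Re s)\<^sup>2" by (rule power_mono) (use assms in auto)
  then have "1 \<le> 4 * (Re s)\<^sup>2" by (simp add: power_divide)
  moreover have "1 + y \<le> 4 * (x + y)" if "1 \<le> 4 * x" "0 \<le> y" for x y :: real
    using that by argo
  ultimately show ?thesis
    unfolding cmod_power2 using zero_le_power2 by blast
qed

lemma laplace_vertical_integrable:
  assumes u: "log_smooth u" and \<sigma>: "\<sigma> > 1/2"
  shows "integrable lborel (\<lambda>t. laplace u (Complex \<sigma> t))"
proof -
  obtain B where B: "\<And>s. \<sigma> \<le> Re s \<and> Re s \<le> \<sigma> \<Longrightarrow> cmod (laplace u s) * cmod s ^ 2 \<le> B"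
    using laplace_rapid_decay[OF u \<sigma>] by metis
  show ?thesis
  proof (rule integrable_inverse_square_decay[OF laplace_vertical_continuous[OF u \<sigma>]])
    fix t
    have "cmod (laplace u (Complex \<sigma> t)) * (1 + t\<^sup>2) \<le> cmod (laplace u (Complex \<sigma> t)) * (4 * (cmod (Complex \<sigma> t))\<^sup>2)"
      using one_plus_Im_square_le[of "Complex \<sigma> t"] \<sigma> by (intro mult_left_mono) auto
    also have "\<dots> \<le> 4 * B" using B[of "Complex \<sigma> t"] by simp
    finally show "norm (laplace u (Complex \<sigma> t)) \<le> 4 * B / (1 + t\<^sup>2)"
      by (simp add: pos_le_divide_eq add_pos_nonneg)
  qed
qed

section \<open>Fourier and Laplace inversion\<close>

text \<open>
  The characteristic function of the normal distribution, rewritten for Lebesgue measure.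
\<close>

lemma gaussian_fourier:
  "integrable lborel (\<lambda>x::real. iexp (t * x) * of_real (exp (- (x\<^sup>2) / 2)))"
  "(LINT x|lborel. iexp (t * x) * of_real (exp (- (x\<^sup>2) / 2))) = of_real (sqrt (2 * pi) * exp (- (t\<^sup>2) / 2))"
proof -
  have i: "integrable lborel (\<lambda>x::real. exp (- (x\<^sup>2) / 2))"
    using integrable_mult_right[OF integrable_std_normal_moment[of 0], of "sqrt (2 * pi)"]
    by (simp add: std_normal_density_def)
  show "integrable lborel (\<lambda>x::real. iexp (t * x) * of_real (exp (- (x\<^sup>2) / 2)))"
    by (rule Bochner_Integration.integrable_bound[OF i]) (auto simp: norm_mult)
  have "of_real (exp (- (t\<^sup>2) / 2)) = (CLINT x|std_normal_distribution. iexp (t * x))"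
    using fun_cong[OF char_std_normal_distribution, of t] by (simp add: char_def)
  also have "\<dots> = (LINT x|lborel. std_normal_density x *\<^sub>R iexp (t * x))"
    by (subst integral_density) auto
  also have "\<dots> = (LINT x|lborel. of_real (1 / sqrt (2 * pi)) * (iexp (t * x) * of_real (exp (- (x\<^sup>2) / 2))))"
    by (intro Bochner_Integration.integral_cong) (auto simp: std_normal_density_def scaleR_conv_of_real)
  also have "\<dots> = of_real (1 / sqrt (2 * pi)) * (LINT x|lborel. iexp (t * x) * of_real (exp (- (x\<^sup>2) / 2)))"
    by (rule integral_mult_right_zero)
  finally show "(LINT x|lborel. iexp (t * x) * of_real (exp (- (x\<^sup>2) / 2))) = of_real (sqrt (2 * pi) * exp (- (t\<^sup>2) / 2))"
    by (simp add: field_simps)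
qed

text \<open>
  A Gaussian factor makes the double integral absolutely convergent. The order of integration can then be
  exchanged, which puts the transform of the Gaussian, again a Gaussian, against \<open>k\<close>.
\<close>

lemma fourier_gaussian_regularised:
  fixes k :: "real \<Rightarrow> complex"
  assumes k: "integrable lborel k" and \<delta>: "\<delta> > 0"
  shows "(LINT t|lborel. (LINT y|lborel. k y * iexp (t * y)) * of_real (exp (- ((\<delta> * t)\<^sup>2) / 2)))
       = of_real (sqrt (2 * pi)) * (LINT u|lborel. k (\<delta> * u) * of_real (exp (- (u\<^sup>2) / 2)))"
proof -
  let ?g = "\<lambda>t y. k y * iexp (t * y) * of_real (exp (- ((\<delta> * t)\<^sup>2) / 2))"
  have [measurable]: "k \<in> borel_measurable borel" using k by auto
  have ig: "integrable lborel (\<lambda>t::real. exp (- ((\<delta> * t)\<^sup>2) / 2))"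
    using lborel_integrable_real_affine[OF integrable_norm[OF gaussian_fourier(1)[of 0]], of \<delta> 0] \<delta> by simp
  have int: "integrable (lborel \<Otimes>\<^sub>M lborel) (\<lambda>(t, y). ?g t y)"
  proof (rule lborel_pair.Fubini_integrable)
    show "integrable lborel (\<lambda>t. LINT y|lborel. norm (case (t, y) of (t, y) \<Rightarrow> ?g t y))"
      using integrable_mult_right[OF ig, of "LINT y|lborel. norm (k y)"] by (simp add: norm_mult)
    show "AE t in lborel. integrable lborel (\<lambda>y. case (t, y) of (t, y) \<Rightarrow> ?g t y)"
    proof (intro AE_I2)
      fix t :: real
      show "integrable lborel (\<lambda>y. case (t, y) of (t, y) \<Rightarrow> ?g t y)"
        using integrable_mult_left[OF integrable_norm[OF k], of "exp (- ((\<delta> * t)\<^sup>2) / 2)"]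
        by (rule Bochner_Integration.integrable_bound) (auto simp: norm_mult)
    qed
  qed measurable
  have inner: "(LINT t|lborel. ?g t y) = of_real (sqrt (2 * pi) / \<delta>) * (k y * of_real (exp (- ((y / \<delta>)\<^sup>2) / 2)))" for y
  proof -
    have "(LINT t|lborel. ?g t y) = k y * (LINT t|lborel. iexp (t * y) * of_real (exp (- ((\<delta> * t)\<^sup>2) / 2)))"
      by (simp add: mult.assoc)
    also have "(LINT t|lborel. iexp (t * y) * of_real (exp (- ((\<delta> * t)\<^sup>2) / 2)))
        = \<bar>1 / \<delta>\<bar> *\<^sub>R (LINT x|lborel. iexp ((y / \<delta>) * x) * of_real (exp (- (x\<^sup>2) / 2)))"
      using \<delta> by (subst lborel_integral_real_affine[where c = "1 / \<delta>" and t = 0]) (auto simp: mult_ac)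
    also have "\<dots> = of_real (sqrt (2 * pi) / \<delta> * exp (- ((y / \<delta>)\<^sup>2) / 2))"
      unfolding gaussian_fourier(2) using \<delta> by (simp add: scaleR_conv_of_real)
    finally show ?thesis by simp
  qed
  have "(LINT t|lborel. (LINT y|lborel. k y * iexp (t * y)) * of_real (exp (- ((\<delta> * t)\<^sup>2) / 2)))
      = (LINT t|lborel. (LINT y|lborel. ?g t y))"
    by simp
  also have "\<dots> = (LINT y|lborel. (LINT t|lborel. ?g t y))"
    using lborel_pair.Fubini_integral[OF int] by simp
  also have "\<dots> = of_real (sqrt (2 * pi) / \<delta>) * (LINT y|lborel. k y * of_real (exp (- ((y / \<delta>)\<^sup>2) / 2)))"
    unfolding inner by (rule integral_mult_right_zero)
  also have "(LINT y|lborel. k y * of_real (exp (- ((y / \<delta>)\<^sup>2) / 2)))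
      = of_real \<delta> * (LINT u|lborel. k (\<delta> * u) * of_real (exp (- (u\<^sup>2) / 2)))"
    using \<delta> by (subst lborel_integral_real_affine[where c = \<delta> and t = 0]) (auto simp: scaleR_conv_of_real)
  finally show ?thesis using \<delta> by simp
qed

text \<open>
  As \<open>\<delta>\<close> tends to 0 in the regularised identity, the Gaussian on the left tends to 1, and on the right
  \<open>k (\<delta> * u)\<close> tends to \<open>k 0\<close>. Both limits are taken by dominated convergence.
\<close>

lemma fourier_inversion_at_0:
  fixes k :: "real \<Rightarrow> complex"
  assumes k: "integrable lborel k" and cont: "continuous_on UNIV k" and bd: "\<And>y. norm (k y) \<le> B"
    and K: "integrable lborel (\<lambda>t. LINT y|lborel. k y * iexp (t * y))"
  shows "(LINT t|lborel. LINT y|lborel. k y * iexp (t * y)) = 2 * of_real pi * k 0"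
proof -
  define K where "K t = (LINT y|lborel. k y * iexp (t * y))" for t :: real
  define \<delta> where "\<delta> n = inverse (real (Suc n))" for n
  have \<delta>: "\<delta> n > 0" for n by (simp add: \<delta>_def)
  have \<delta>0: "\<delta> \<longlonglongrightarrow> 0" unfolding \<delta>_def by (rule LIMSEQ_inverse_real_of_nat)
  have Kint: "integrable lborel K" using K unfolding K_def .
  then have [measurable]: "K \<in> borel_measurable borel" by auto
  have [measurable]: "k \<in> borel_measurable borel" using k by auto
  have "(\<lambda>n. LINT t|lborel. K t * of_real (exp (- ((\<delta> n * t)\<^sup>2) / 2))) \<longlonglongrightarrow> (LINT t|lborel. K t)"
  proof (rule integral_dominated_convergence[where w = "\<lambda>t. norm (K t)"])
    show "AE t in lborel. (\<lambda>n. K t * of_real (exp (- ((\<delta> n * t)\<^sup>2) / 2))) \<longlonglongrightarrow> K t"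
    proof (intro AE_I2)
      fix t :: real
      have "(\<lambda>n. K t * of_real (exp (- ((\<delta> n * t)\<^sup>2) / 2))) \<longlonglongrightarrow> K t * of_real (exp (- ((0 * t)\<^sup>2) / 2))"
        by (intro tendsto_intros \<delta>0) simp
      then show "(\<lambda>n. K t * of_real (exp (- ((\<delta> n * t)\<^sup>2) / 2))) \<longlonglongrightarrow> K t" by simp
    qed
  qed (use Kint in \<open>auto simp: norm_mult intro!: mult_left_le\<close>)
  moreover have "(\<lambda>n. LINT t|lborel. K t * of_real (exp (- ((\<delta> n * t)\<^sup>2) / 2))) \<longlonglongrightarrow> 2 * of_real pi * k 0"
  proof -
    have "(\<lambda>n. LINT u|lborel. k (\<delta> n * u) * of_real (exp (- (u\<^sup>2) / 2)))
        \<longlonglongrightarrow> (LINT u|lborel. k 0 * of_real (exp (- (u\<^sup>2) / 2)))"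
    proof (rule integral_dominated_convergence[where w = "\<lambda>u. B * exp (- (u\<^sup>2) / 2)"])
      show "integrable lborel (\<lambda>u. B * exp (- (u\<^sup>2) / 2))"
        using integrable_norm[OF gaussian_fourier(1)[of 0]] by simp
      show "AE u in lborel. (\<lambda>n. k (\<delta> n * u) * of_real (exp (- (u\<^sup>2) / 2))) \<longlonglongrightarrow> k 0 * of_real (exp (- (u\<^sup>2) / 2))"
      proof (intro AE_I2 tendsto_intros)
        fix u :: real
        have "(\<lambda>n. \<delta> n * u) \<longlonglongrightarrow> 0 * u" by (intro tendsto_intros \<delta>0)
        then show "(\<lambda>n. k (\<delta> n * u)) \<longlonglongrightarrow> k 0"
          using cont by (auto intro: continuous_on_tendsto_compose)
      qed
    qed (use bd in \<open>auto simp: norm_mult\<close>)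
    also have "(LINT u|lborel. k 0 * of_real (exp (- (u\<^sup>2) / 2))) = k 0 * of_real (sqrt (2 * pi))"
      using gaussian_fourier(2)[of 0] by simp
    finally have "(\<lambda>n. of_real (sqrt (2 * pi)) * (LINT u|lborel. k (\<delta> n * u) * of_real (exp (- (u\<^sup>2) / 2))))
        \<longlonglongrightarrow> of_real (sqrt (2 * pi)) * (k 0 * of_real (sqrt (2 * pi)))"
      by (intro tendsto_intros)
    also have "of_real (sqrt (2 * pi)) * (k 0 * of_real (sqrt (2 * pi))) = 2 * of_real pi * k 0"
      using arg_cong[OF real_sqrt_mult_self[of "2 * pi"], of complex_of_real]
      by (simp add: mult_ac del: real_sqrt_mult_self)
    finally show ?thesis
      unfolding K_def fourier_gaussian_regularised[OF k \<delta>] .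
  qed
  ultimately have "(LINT t|lborel. K t) = 2 * of_real pi * k 0" by (rule LIMSEQ_unique)
  then show ?thesis by (simp add: K_def)
qed

text \<open>
  On the vertical line through \<open>\<sigma>\<close> the Laplace transform of \<open>u\<close> is the Fourier transform of
  \<open>u y * exp (\<sigma> * y)\<close>.
\<close>

lemma laplace_inversion:
  assumes u: "log_smooth u" and \<sigma>: "\<sigma> > 1/2"
  shows "integrable lborel (\<lambda>t. laplace u (Complex \<sigma> t) * exp (- Complex \<sigma> t * of_real x))" (is ?int)
    and "(LINT t|lborel. laplace u (Complex \<sigma> t) * exp (- Complex \<sigma> t * of_real x)) = 2 * of_real pi * u x" (is ?inv)
proof -
  \<comment> \<open>The translation by \<open>x\<close> moves the point of evaluation to 0, where the Fourier inversion is available.\<close>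
  define k where "k y = u (x + y) * exp (of_real (\<sigma> * y))" for y
  have cont: "continuous_on UNIV k"
    unfolding k_def by (intro continuous_intros continuous_on_compose2[OF log_smooth_continuous[OF u, of UNIV]]) auto
  have K: "integrable lborel (\<lambda>y. k y * iexp (t * y))"
    "(LINT y|lborel. k y * iexp (t * y)) = laplace u (Complex \<sigma> t) * exp (- Complex \<sigma> t * of_real x)" for t
  proof -
    let ?h = "\<lambda>y. exp (- Complex \<sigma> t * of_real x) * (u y * exp (Complex \<sigma> t * of_real y))"
    have eq: "?h (x + 1 * y) = k y * iexp (t * y)" for y
      by (simp add: k_def mult.assoc mult.left_commute flip: exp_add) (simp add: Complex_eq algebra_simps)
    have h: "integrable lborel ?h"
      using log_smooth_integrable[OF u, of "Complex \<sigma> t"] \<sigma> by (intro integrable_mult_right) auto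
    show "integrable lborel (\<lambda>y. k y * iexp (t * y))"
      using lborel_integrable_real_affine[OF h, of 1 x] unfolding eq by simp
    show "(LINT y|lborel. k y * iexp (t * y)) = laplace u (Complex \<sigma> t) * exp (- Complex \<sigma> t * of_real x)"
      using lborel_integral_real_affine[of 1 ?h x] unfolding eq laplace_def
      by (simp only: integral_mult_right_zero mult.commute[of _ "exp (- Complex \<sigma> t * of_real x)"]) simp
  qed
  have k: "integrable lborel k" using K(1)[of 0] by simp
  obtain B where B: "\<And>y. cmod (u y) * exp (\<sigma> * y) \<le> B" using log_smooth_bounded[OF u \<sigma>] by blast
  have bd: "norm (k y) \<le> B * exp (- \<sigma> * x)" for y
  proof -
    have "norm (k y) = (cmod (u (x + y)) * exp (\<sigma> * (x + y))) * exp (- \<sigma> * x)"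
      by (simp add: k_def norm_mult mult.assoc flip: exp_add) (simp add: algebra_simps)
    also have "\<dots> \<le> B * exp (- \<sigma> * x)" by (intro mult_right_mono B) auto
    finally show ?thesis .
  qed
  show int: ?int
  proof (rule Bochner_Integration.integrable_bound)
    show "integrable lborel (\<lambda>t. laplace u (Complex \<sigma> t) * of_real (exp (- \<sigma> * x)))"
      using laplace_vertical_integrable[OF u \<sigma>] by (rule integrable_mult_left)
    show "(\<lambda>t. laplace u (Complex \<sigma> t) * exp (- Complex \<sigma> t * of_real x)) \<in> borel_measurable lborel"
      unfolding measurable_lborel2
      by (intro borel_measurable_continuous_onI continuous_intros laplace_vertical_continuous[OF u \<sigma>])
  qed (simp add: norm_mult)
  show ?inv
    using fourier_inversion_at_0[OF k cont bd, unfolded K(2), OF int] by (simp add: k_def)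
qed

section \<open>Moving a vertical line of integration\<close>

text \<open>
  Cauchy's theorem for a strip, by way of a primitive on this convex set: the difference of the two vertical
  integrals, cut off at height \<open>n\<close>, is up to a factor of modulus 1 a difference of two increments of the primitive along
  horizontal segments, and these are bounded by the width of the strip times the supremum of the integrand there,
  which tends to 0.
\<close>

lemma integral_vertical_line_shift:
  fixes f :: "complex \<Rightarrow> complex"
  assumes ab: "a \<le> b"
    and diff: "\<And>s. a \<le> Re s \<Longrightarrow> Re s \<le> b \<Longrightarrow> f field_differentiable at s"
    and bd: "\<And>s. a \<le> Re s \<Longrightarrow> Re s \<le> b \<Longrightarrow> norm (f s) \<le> B / (1 + (Im s)\<^sup>2)"
  shows "(LINT t|lborel. f (Complex a t)) = (LINT t|lborel. f (Complex b t))"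
proof -
  define S where "S = {s. a \<le> Re s \<and> Re s \<le> b}"
  have "convex S"
    unfolding S_def Collect_conj_eq by (intro convex_Int convex_halfspace_Re_ge convex_halfspace_Re_le)
  have cS: "continuous_on S f"
    using diff by (auto simp: S_def intro!: continuous_at_imp_continuous_on field_differentiable_imp_continuous_at)
  obtain P where P: "\<And>s. s \<in> S \<Longrightarrow> (P has_field_derivative f s) (at s within S)"
  proof (rule holomorphic_convex_primitive[OF \<open>convex S\<close> _ cS, of "{}"])
    show "f field_differentiable at x" if "x \<in> interior S - {}" for x
      using that interior_subset diff by (auto simp: S_def)
  qed auto
  \<comment> \<open>The primitive \<open>P\<close> turns the integral over a vertical segment into a difference of its values at the end points.\<close>
  have line: "(\<lambda>n. P (Complex \<sigma> (real n)) - P (Complex \<sigma> (- real n))) \<longlonglongrightarrow> \<i> * (LINT t|lborel. f (Complex \<sigma> t))"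
    if \<sigma>: "a \<le> \<sigma>" "\<sigma> \<le> b" for \<sigma>
  proof -
    have cont: "continuous_on UNIV (\<lambda>t. f (Complex \<sigma> t))"
      by (rule continuous_on_compose2[OF cS]) (auto simp: S_def \<sigma> intro!: continuous_intros)
    have int: "integrable lborel (\<lambda>t. f (Complex \<sigma> t))"
      by (rule integrable_inverse_square_decay[OF cont]) (use bd[of "Complex \<sigma> t" for t] \<sigma> in auto)
    have "P (Complex \<sigma> (real n)) - P (Complex \<sigma> (- real n)) = \<i> * (LINT t:{- real n..real n}|lborel. f (Complex \<sigma> t))" for n
    proof -
      have "((\<lambda>t. \<i> * f (Complex \<sigma> t)) has_integral P (Complex \<sigma> (real n)) - P (Complex \<sigma> (- real n))) {- real n..real n}"
      proof (rule fundamental_theorem_of_calculus)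
        fix t :: real
        have "((\<lambda>t. Complex \<sigma> t) has_vector_derivative \<i>) (at t within {- real n..real n})"
          unfolding Complex_eq by (auto intro!: derivative_eq_intros)
        moreover have "(P has_field_derivative f (Complex \<sigma> t)) (at (Complex \<sigma> t) within (\<lambda>t. Complex \<sigma> t) ` {- real n..real n})"
          by (rule has_field_derivative_subset[OF P]) (auto simp: S_def \<sigma>)
        ultimately show "((\<lambda>t. P (Complex \<sigma> t)) has_vector_derivative \<i> * f (Complex \<sigma> t)) (at t within {- real n..real n})"
          by (rule field_vector_diff_chain_within[unfolded o_def])
      qed simp
      moreover have "set_integrable lborel {- real n..real n} (\<lambda>t. \<i> * f (Complex \<sigma> t))"
        unfolding set_integrable_def using int by (intro integrable_mult_indicator) auto
      ultimately have "P (Complex \<sigma> (real n)) - P (Complex \<sigma> (- real n)) = (LINT t:{- real n..real n}|lborel. \<i> * f (Complex \<sigma> t))"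
        using set_borel_integral_eq_integral(2) by (metis integral_unique)
      then show ?thesis by simp
    qed
    then show ?thesis
      using tendsto_mult_left[OF integral_exhaustion_limit[OF int, of 0], of \<i>] by simp
  qed
  have horiz: "norm (P (Complex b t) - P (Complex a t)) \<le> B / (1 + t\<^sup>2) * (b - a)" for t
  proof -
    have "norm (P (Complex b t) - P (Complex a t)) \<le> B / (1 + t\<^sup>2) * norm (Complex b t - Complex a t)"
    proof (rule field_differentiable_bound[of "S \<inter> {s. Im s = t}" P f])
      show "convex (S \<inter> {s. Im s = t})"
        using convex_Int[OF convex_halfspace_Im_ge convex_halfspace_Im_le, of t t]
        by (intro convex_Int \<open>convex S\<close>) (auto simp: Int_def antisym_conv convex_halfspace_Im_ge elim!: back_subst[of convex] intro!: Collect_cong)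
      show "(P has_field_derivative f z) (at z within S \<inter> {s. Im s = t})" if "z \<in> S \<inter> {s. Im s = t}" for z
        using that by (intro has_field_derivative_subset[OF P]) auto
      show "norm (f z) \<le> B / (1 + t\<^sup>2)" if "z \<in> S \<inter> {s. Im s = t}" for z
        using that bd[of z] by (auto simp: S_def)
    qed (use ab in \<open>auto simp: S_def\<close>)
    also have "norm (Complex b t - Complex a t) = b - a"
      using ab by (simp add: cmod_def)
    finally show ?thesis .
  qed
  have hlim: "(\<lambda>n. P (Complex b (c * real n)) - P (Complex a (c * real n))) \<longlonglongrightarrow> 0" if "c\<^sup>2 = 1" for c
  proof (rule Lim_null_comparison)
    show "\<forall>\<^sub>F n in sequentially. norm (P (Complex b (c * real n)) - P (Complex a (c * real n))) \<le> B / (1 + (real n)\<^sup>2) * (b - a)"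
      using horiz[of "c * real n" for n] that by (simp add: power_mult_distrib)
    show "(\<lambda>n. B / (1 + (real n)\<^sup>2) * (b - a)) \<longlonglongrightarrow> 0"
      by real_asymp
  qed
  have "(\<lambda>n. (P (Complex b (real n)) - P (Complex b (- real n))) - (P (Complex a (real n)) - P (Complex a (- real n))))
     \<longlonglongrightarrow> \<i> * (LINT t|lborel. f (Complex b t)) - \<i> * (LINT t|lborel. f (Complex a t))"
    using ab by (intro tendsto_diff line) auto
  moreover have "(\<lambda>n. (P (Complex b (real n)) - P (Complex b (- real n))) - (P (Complex a (real n)) - P (Complex a (- real n)))) \<longlonglongrightarrow> 0"
    using tendsto_diff[OF hlim[of 1] hlim[of "-1"]] by (simp add: algebra_simps)
  ultimately have "\<i> * (LINT t|lborel. f (Complex b t)) - \<i> * (LINT t|lborel. f (Complex a t)) = 0"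
    by (rule LIMSEQ_unique)
  then show ?thesis by simp
qed

section \<open>From smooth vectors on the half-line to the logarithmic coordinate\<close>

lemma H_infty_has_derivative:
  assumes "\<phi> \<in> H_infty" "x > 0"
  shows "(nth_deriv n \<phi> has_vector_derivative nth_deriv (Suc n) \<phi> x) (at x)"
  using assms by (auto simp: H_infty_def smooth_pos_def nth_deriv_def vector_derivative_works)

lemma H_infty_log_L2:
  assumes \<phi>: "\<phi> \<in> H_infty" and ij: "i \<le> j"
  shows "integrable lborel (\<lambda>y. (cmod (of_real (exp (real j * y)) * nth_deriv i \<phi> (exp y)))\<^sup>2 * exp ((2 * real m + 1) * y))"
proof -
  let ?f = "\<lambda>x. (cmod (of_real (x ^ (j + m)) * nth_deriv i \<phi> x))\<^sup>2"
  have "(\<lambda>x. of_real (x ^ (j + m)) * nth_deriv i \<phi> x) \<in> L2_pos"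
    using \<phi> ij by (auto simp: H_infty_def)
  then have f: "set_integrable lborel {0<..} ?f"
    by (simp add: L2_pos_def)
  then have "set_borel_measurable lborel {0<..} ?f"
    unfolding set_integrable_def set_borel_measurable_def by (rule borel_measurable_integrable)
  from log_substitution(1)[OF this] f
  have "integrable lborel (\<lambda>y. exp y *\<^sub>R ?f (exp y))" by simp
  also have "(\<lambda>y. exp y *\<^sub>R ?f (exp y)) =
    (\<lambda>y. (cmod (of_real (exp (real j * y)) * nth_deriv i \<phi> (exp y)))\<^sup>2 * exp ((2 * real m + 1) * y))"
  proof
    fix y :: real
    have "exp y * (exp y ^ (j + m))\<^sup>2 = (exp (real j * y))\<^sup>2 * exp ((2 * real m + 1) * y)"
      by (simp add: power2_eq_square algebra_simps flip: exp_of_nat_mult exp_add)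
    then show "exp y *\<^sub>R ?f (exp y) = (cmod (of_real (exp (real j * y)) * nth_deriv i \<phi> (exp y)))\<^sup>2 * exp ((2 * real m + 1) * y)"
      by (simp add: norm_mult power_mult_distrib norm_power mult_ac)
  qed
  finally show ?thesis .
qed

text \<open>
  The span of the functions \<open>x ^ j\<close> times the derivative of order \<open>i\<close> of \<open>\<phi>\<close> times the phase \<open>exp (c * x)\<close>, for
  \<open>i \<le> j\<close>, in the coordinate \<open>y = ln x\<close>. It contains the twist of \<open>\<phi>\<close> by the phase and is closed
  under differentiation, which makes it an invariant for the coinduction.
\<close>

inductive twisted_span :: "(real \<Rightarrow> complex) \<Rightarrow> complex \<Rightarrow> (real \<Rightarrow> complex) \<Rightarrow> bool" for \<phi> c where
  monomial: "i \<le> j \<Longrightarrow> twisted_span \<phi> c (\<lambda>y. of_real (exp (real j * y)) * nth_deriv i \<phi> (exp y) * exp (c * of_real (exp y)))"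
| scale: "twisted_span \<phi> c u \<Longrightarrow> twisted_span \<phi> c (\<lambda>y. b * u y)"
| add: "twisted_span \<phi> c u \<Longrightarrow> twisted_span \<phi> c v \<Longrightarrow> twisted_span \<phi> c (\<lambda>y. u y + v y)"

lemma twisted_span_deriv:
  assumes \<phi>: "\<phi> \<in> H_infty" and "twisted_span \<phi> c u"
  shows "\<exists>v. twisted_span \<phi> c v \<and> (\<forall>y. (u has_vector_derivative v y) (at y))"
  using assms(2)
proof induction
  case (monomial i j)
  define M where "M l n y = complex_of_real (exp (real l * y)) * nth_deriv n \<phi> (exp y) * exp (c * of_real (exp y))" for l n y
  have M: "twisted_span \<phi> c (M l n)" if "n \<le> l" for l n
    unfolding M_def using that by (rule twisted_span.monomial)
  \<comment> \<open>The product rule: every derivative of \<open>\<phi>\<close> or of the phase comes with a factor \<open>exp y\<close>, so the exponent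
    stays at least the order of differentiation.\<close>
  let ?v = "\<lambda>y. of_nat j * M j i y + M (Suc j) (Suc i) y + c * M (Suc j) i y"
  have "twisted_span \<phi> c ?v"
    using monomial by (intro twisted_span.scale twisted_span.add M) auto
  moreover have "(M j i has_vector_derivative ?v y) (at y)" for y
  proof -
    have d: "((\<lambda>y. nth_deriv i \<phi> (exp y)) has_vector_derivative exp y *\<^sub>R nth_deriv (Suc i) \<phi> (exp y)) (at y)"
      using vector_diff_chain_at[of exp "exp y" y "nth_deriv i \<phi>"] H_infty_has_derivative[OF \<phi>, of "exp y" i]
      by (auto simp: o_def has_real_derivative_iff_has_vector_derivative[symmetric] intro: DERIV_exp)
    have e: "((\<lambda>y. complex_of_real (exp (real j * y))) has_vector_derivative of_real (exp (real j * y) * real j)) (at y)"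
      by (rule has_vector_derivative_of_real) (auto intro!: derivative_eq_intros simp: has_real_derivative_iff_has_vector_derivative[symmetric])
    have x: "((\<lambda>y. complex_of_real (exp y)) has_vector_derivative of_real (exp y)) (at y)"
      by (rule has_vector_derivative_of_real) (auto intro!: derivative_eq_intros simp: has_real_derivative_iff_has_vector_derivative[symmetric])
    have g: "((\<lambda>y. exp (c * complex_of_real (exp y))) has_vector_derivative of_real (exp y) * (c * exp (c * of_real (exp y)))) (at y)"
    proof -
      have "((\<lambda>z. exp (c * z)) has_field_derivative c * exp (c * of_real (exp y))) (at (complex_of_real (exp y)))"
        by (auto intro!: derivative_eq_intros)
      from field_vector_diff_chain_at[OF x this] show ?thesis by (simp add: o_def)
    qed
    show ?thesis
      unfolding M_def
      by (rule has_vector_derivative_eq_rhs[OF has_vector_derivative_mult[OF has_vector_derivative_mult[OF e d] g]])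
         (simp add: algebra_simps scaleR_conv_of_real exp_add)
  qed
  ultimately show ?case unfolding M_def by blast
next
  case (scale u b)
  then obtain v where "twisted_span \<phi> c v" "\<forall>y. (u has_vector_derivative v y) (at y)" by blast
  then show ?case
    by (intro exI[of _ "\<lambda>y. b * v y"]) (auto intro: twisted_span.scale has_vector_derivative_mult_right)
next
  case (add u1 u2)
  then obtain v1 v2 where "twisted_span \<phi> c v1" "\<forall>y. (u1 has_vector_derivative v1 y) (at y)"
    "twisted_span \<phi> c v2" "\<forall>y. (u2 has_vector_derivative v2 y) (at y)" by blast
  then show ?case
    by (intro exI[of _ "\<lambda>y. v1 y + v2 y"]) (auto intro: twisted_span.add has_vector_derivative_add)
qed

text \<open>
  An imaginary \<open>c\<close> gives a phase of modulus 1, so only the weighted bounds on the derivatives of \<open>\<phi>\<close> matter.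
\<close>

lemma twisted_span_L2:
  assumes \<phi>: "\<phi> \<in> H_infty" and c: "Re c = 0" and "twisted_span \<phi> c u"
  shows "integrable lborel (\<lambda>y. (cmod (u y))\<^sup>2 * exp ((2 * real m + 1) * y))"
  using assms(3)
proof induction
  case (monomial i j)
  then show ?case
    using H_infty_log_L2[OF \<phi>, of i j m] c by (simp add: norm_mult)
next
  case (scale u b)
  then show ?case
    using integrable_mult_right[of "(cmod b)\<^sup>2"] by (simp add: norm_mult power_mult_distrib mult.assoc)
next
  case (add u v)
  have "(cmod (u y + v y))\<^sup>2 * exp ((2 * real m + 1) * y)
      \<le> 2 * ((cmod (u y))\<^sup>2 * exp ((2 * real m + 1) * y)) + 2 * ((cmod (v y))\<^sup>2 * exp ((2 * real m + 1) * y))" for y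
  proof -
    have "(cmod (u y + v y))\<^sup>2 \<le> (cmod (u y) + cmod (v y))\<^sup>2"
      by (intro power_mono norm_triangle_ineq) auto
    also have "\<dots> \<le> 2 * (cmod (u y))\<^sup>2 + 2 * (cmod (v y))\<^sup>2"
      using sum_squares_bound[of "cmod (u y)" "cmod (v y)"] by (simp add: power2_sum)
    finally have "(cmod (u y + v y))\<^sup>2 * exp ((2 * real m + 1) * y)
       \<le> (2 * (cmod (u y))\<^sup>2 + 2 * (cmod (v y))\<^sup>2) * exp ((2 * real m + 1) * y)"
      by (rule mult_right_mono) simp
    then show ?thesis by (simp add: algebra_simps)
  qed
  note le = this
  have cont: "continuous_on UNIV (\<lambda>y. u y + v y)"
    using twisted_span_deriv[OF \<phi> twisted_span.add[OF add.hyps]]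
    by (blast intro: continuous_at_imp_continuous_on has_vector_derivative_continuous)
  show ?case
  proof (rule Bochner_Integration.integrable_bound)
    show "integrable lborel (\<lambda>y. 2 * ((cmod (u y))\<^sup>2 * exp ((2 * real m + 1) * y)) + 2 * ((cmod (v y))\<^sup>2 * exp ((2 * real m + 1) * y)))"
      using add.IH by (intro Bochner_Integration.integrable_add integrable_mult_right)
    show "(\<lambda>y. (cmod (u y + v y))\<^sup>2 * exp ((2 * real m + 1) * y)) \<in> borel_measurable lborel"
      unfolding measurable_lborel2 by (intro borel_measurable_continuous_onI continuous_intros cont)
  qed (use le in \<open>auto intro!: order_trans[OF _ abs_ge_self]\<close>)
qed

lemma twisted_span_log_smooth:
  assumes \<phi>: "\<phi> \<in> H_infty" and c: "Re c = 0" and "twisted_span \<phi> c u"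
  shows "log_smooth u"
  using assms(3)
proof (coinduction arbitrary: u rule: log_smooth.coinduct)
  case log_smooth
  then show ?case
    using twisted_span_deriv[OF \<phi> log_smooth] twisted_span_L2[OF \<phi> c log_smooth] by blast
qed

lemma H_infty_twist_log_smooth:
  assumes "\<phi> \<in> H_infty"
  shows "log_smooth (\<lambda>y. \<phi> (exp y) * exp (- 2 * of_real pi * \<i> * of_real T * of_real (exp y)))"
  using twisted_span_log_smooth[OF assms _ twisted_span.monomial[of 0 0 \<phi> "- 2 * of_real pi * \<i> * of_real T"]]
  by (simp add: nth_deriv_def)

lemma mellin_eq_laplace:
  assumes cont: "continuous_on UNIV (\<lambda>y. f (exp y))"
  shows "mellin f s = laplace (\<lambda>y. f (exp y)) s"
proof -
  have [measurable]: "(\<lambda>y. f (exp y)) \<in> borel_measurable borel"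
    using cont by (rule borel_measurable_continuous_onI)
  let ?g = "\<lambda>x. f x * of_real x powr s / of_real x"
  have "(\<lambda>x. indicator {0<..} x *\<^sub>R (f (exp (ln x)) * exp (s * of_real (ln x)) / complex_of_real x)) \<in> borel_measurable lborel"
    by measurable
  also have "(\<lambda>x. indicator {0<..} x *\<^sub>R (f (exp (ln x)) * exp (s * of_real (ln x)) / complex_of_real x)) = (\<lambda>x. indicator {0<..} x *\<^sub>R ?g x)"
    by (auto simp: fun_eq_iff powr_def Ln_of_real split: split_indicator)
  finally have "set_borel_measurable lborel {0<..} ?g"
    by (simp add: set_borel_measurable_def)
  from log_substitution(2)[OF this] show ?thesis
    by (simp add: mellin_def laplace_def powr_def scaleR_conv_of_real Ln_of_real flip: exp_of_real)
qed

section \<open>Dirichlet series against transforms of smooth vectors\<close>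

lemma dirichlet_abs_summable:
  fixes d :: "nat \<Rightarrow> complex"
  assumes growth: "\<And>\<tau>::real. \<tau> > 0 \<Longrightarrow> \<exists>C::real. \<forall>n\<ge>1. cmod (d n) \<le> C * real n powr \<tau>"
    and \<sigma>: "\<sigma> > 1"
  shows "summable (\<lambda>n. cmod (d (Suc n)) * real (Suc n) powr (- \<sigma>))"
proof -
  \<comment> \<open>Positive, and small enough that \<open>\<tau> - \<sigma> < -1\<close>.\<close>
  define \<tau> where "\<tau> = (\<sigma> - 1) / 2"
  obtain C where C: "\<And>n. n \<ge> 1 \<Longrightarrow> cmod (d n) \<le> C * real n powr \<tau>"
    using growth[of \<tau>] \<sigma> by (auto simp: \<tau>_def)
  have "summable (\<lambda>n. real n powr (\<tau> - \<sigma>))"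
    unfolding summable_real_powr_iff using \<sigma> by (simp add: \<tau>_def field_simps)
  then have "summable (\<lambda>n. C * real (Suc n) powr (\<tau> - \<sigma>))"
    by (intro summable_mult) (subst summable_Suc_iff)
  then show ?thesis
  proof (rule summable_comparison_test')
    fix n
    have "cmod (d (Suc n)) * real (Suc n) powr (- \<sigma>) \<le> (C * real (Suc n) powr \<tau>) * real (Suc n) powr (- \<sigma>)"
      by (intro mult_right_mono C) auto
    then show "norm (cmod (d (Suc n)) * real (Suc n) powr (- \<sigma>)) \<le> C * real (Suc n) powr (\<tau> - \<sigma>)"
      by (simp add: mult.assoc flip: powr_add)
  qed
qed

lemma infsum_from_1:
  fixes f :: "nat \<Rightarrow> complex"
  assumes "summable (\<lambda>n. norm (f (Suc n)))"
  shows "f summable_on {1..}" and "infsum f {1..} = (\<Sum>n. f (Suc n))"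
proof -
  have "((\<lambda>n. f (Suc n)) has_sum (\<Sum>n. f (Suc n))) UNIV"
    using norm_summable_imp_has_sum[OF assms summable_sums[OF summable_norm_cancel[OF assms]]] .
  moreover have "range Suc = {1..}"
    by (force simp: image_iff gr0_conv_Suc Suc_le_eq)
  ultimately have "(f has_sum (\<Sum>n. f (Suc n))) {1..}"
    using has_sum_reindex[of Suc UNIV f] by (simp add: o_def)
  then show "f summable_on {1..}" and "infsum f {1..} = (\<Sum>n. f (Suc n))"
    by (auto simp: summable_on_def infsumI)
qed

text \<open>
  The formula on a line in the half-plane of absolute convergence. Laplace inversion at \<open>ln (a * n)\<close> recovers
  \<open>u (ln (a * n))\<close>, and the sum over \<open>n\<close> passes through the integral, since the norms of the terms are a summable
  sequence times one integrable function.
\<close>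

lemma dirichlet_laplace_pairing:
  fixes d :: "nat \<Rightarrow> complex"
  assumes u: "log_smooth u" and \<sigma>: "\<sigma> > 1" and a: "a > 0"
    and growth: "\<And>\<tau>::real. \<tau> > 0 \<Longrightarrow> \<exists>C::real. \<forall>n\<ge>1. cmod (d n) \<le> C * real n powr \<tau>"
  defines "F \<equiv> \<lambda>t. dirichlet d (Complex \<sigma> t) * laplace u (Complex \<sigma> t) * of_real a powr (1/2 - Complex \<sigma> t)"
  shows "(\<lambda>n. d n * u (ln (a * real n))) summable_on {1..}"
    and "integrable lborel F"
    and "(LINT t|lborel. F t) = 2 * of_real pi * of_real (a powr (1/2)) * (\<Sum>\<^sub>\<infinity>n\<in>{1..}. d n * u (ln (a * real n)))"
proof -
  have \<sigma>': "\<sigma> > 1/2" using \<sigma> by simp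
  note ds = dirichlet_abs_summable[OF growth \<sigma>]
  define y where "y n = ln (a * real (Suc n))" for n
  have ey: "exp (- \<sigma> * y n) = a powr (- \<sigma>) * real (Suc n) powr (- \<sigma>)" for n
    using a by (simp add: y_def powr_def ln_mult exp_add[symmetric] algebra_simps del: of_nat_Suc)
  obtain B where B: "\<And>y. cmod (u y) * exp (\<sigma> * y) \<le> B" using log_smooth_bounded[OF u \<sigma>'] by blast
  have "summable (\<lambda>n. norm (d (Suc n) * u (y n)))"
  proof (rule summable_comparison_test')
    show "summable (\<lambda>n. B * a powr (- \<sigma>) * (cmod (d (Suc n)) * real (Suc n) powr (- \<sigma>)))"
      by (rule summable_mult[OF ds])
    fix n
    have "cmod (u (y n)) = cmod (u (y n)) * exp (\<sigma> * y n) * exp (- \<sigma> * y n)"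
      by (simp add: mult.assoc flip: exp_add)
    also have "\<dots> \<le> B * exp (- \<sigma> * y n)" by (intro mult_right_mono B) simp
    finally have "cmod (d (Suc n)) * cmod (u (y n)) \<le> cmod (d (Suc n)) * (B * exp (- \<sigma> * y n))"
      by (rule mult_left_mono) simp
    then show "norm (norm (d (Suc n) * u (y n))) \<le> B * a powr (- \<sigma>) * (cmod (d (Suc n)) * real (Suc n) powr (- \<sigma>))"
      unfolding ey by (simp add: norm_mult mult_ac)
  qed
  note us = infsum_from_1[of "\<lambda>n. d n * u (ln (a * real n))", folded y_def, OF this]
  show "(\<lambda>n. d n * u (ln (a * real n))) summable_on {1..}" by (rule us(1))
  \<comment> \<open>The contribution of the term with index \<open>Suc n\<close>, in the form to which Laplace inversion applies at \<open>y n\<close>;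
    \<open>G_eq\<close> below brings it into the form of a term of the Dirichlet series.\<close>
  define G where "G n t = d (Suc n) * of_real (a powr (1/2)) * (laplace u (Complex \<sigma> t) * exp (- Complex \<sigma> t * of_real (y n)))" for n t
  have G_int: "integrable lborel (G n)" for n
    unfolding G_def by (intro integrable_mult_right laplace_inversion(1)[OF u \<sigma>'])
  have G_val: "(LINT t|lborel. G n t) = 2 * of_real pi * of_real (a powr (1/2)) * (d (Suc n) * u (y n))" for n
    unfolding G_def integral_mult_right_zero laplace_inversion(2)[OF u \<sigma>'] by simp
  have G_norm: "norm (G n t) = a powr (1/2) * a powr (- \<sigma>) * norm (laplace u (Complex \<sigma> t)) * (cmod (d (Suc n)) * real (Suc n) powr (- \<sigma>))" for n t
    using ey[of n] by (simp add: G_def norm_mult)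
  have G_eq: "G n t = d (Suc n) * of_nat (Suc n) powr (- Complex \<sigma> t) * (laplace u (Complex \<sigma> t) * of_real a powr (1/2 - Complex \<sigma> t))" for n t
  proof -
    have 1: "(of_nat (Suc n) :: complex) powr (- s) = exp (- s * of_real (ln (real (Suc n))))" for s
      by (simp add: powr_def Ln_of_nat del: of_nat_Suc)
    have 2: "complex_of_real a powr (1/2 - s) = of_real (a powr (1/2)) * exp (- s * of_real (ln a))" for s
      using a by (simp add: powr_def Ln_of_real algebra_simps flip: exp_of_real exp_add)
    have 3: "exp (- s * of_real (y n)) = exp (- s * of_real (ln a)) * exp (- s * of_real (ln (real (Suc n))))" for s :: complex
      using a by (simp add: y_def ln_mult algebra_simps del: of_nat_Suc flip: exp_add)
    show ?thesis unfolding G_def 1 2 3 by (simp only: mult_ac)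
  qed
  have G_sum: "summable (\<lambda>n. norm (G n t))" for t
    unfolding G_norm by (rule summable_mult[OF ds])
  have G_F: "(\<Sum>n. G n t) = F t" for t
  proof -
    let ?s = "Complex \<sigma> t"
    have nrm: "norm (d (Suc n) * of_nat (Suc n) powr (- ?s)) = cmod (d (Suc n)) * real (Suc n) powr (- \<sigma>)" for n
      by (simp add: norm_mult norm_powr_real_powr' powr_def Ln_of_nat del: of_nat_Suc)
    have s: "summable (\<lambda>n. norm (d (Suc n) * of_nat (Suc n) powr (- ?s)))"
      unfolding nrm by (rule ds)
    show ?thesis
      unfolding G_eq F_def dirichlet_def infsum_from_1(2)[OF s] suminf_mult2[OF summable_norm_cancel[OF s], symmetric]
      by (simp only: mult.assoc)
  qed
  have G_int_sum: "summable (\<lambda>n. LINT t|lborel. norm (G n t))"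
    unfolding G_norm by (simp add: summable_mult ds del: of_nat_Suc)
  note exch = G_int AE_I2[OF G_sum] G_int_sum
  show "integrable lborel F"
    using integrable_suminf[OF exch] unfolding G_F .
  have "(LINT t|lborel. F t) = (\<Sum>n. LINT t|lborel. G n t)"
    using integral_suminf[OF exch] unfolding G_F .
  also have "\<dots> = 2 * of_real pi * of_real (a powr (1/2)) * (\<Sum>n. d (Suc n) * u (y n))"
    unfolding G_val using summable_norm_cancel[OF \<open>summable (\<lambda>n. norm (d (Suc n) * u (y n)))\<close>]
    by (rule suminf_mult)
  finally show "(LINT t|lborel. F t) = 2 * of_real pi * of_real (a powr (1/2)) * (\<Sum>\<^sub>\<infinity>n\<in>{1..}. d n * u (ln (a * real n)))"
    unfolding us(2) .
qed

text \<open>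
  The rapid decay of the transform on vertical strips absorbs the polynomial growth of \<open>L\<close>.
\<close>

lemma continued_L_laplace_decay:
  fixes L :: "complex \<Rightarrow> complex"
  assumes u: "log_smooth u" and r: "r > 1/2" and a: "a > 0"
    and L: "\<And>s. r \<le> Re s \<Longrightarrow> Re s \<le> b \<Longrightarrow> cmod (L s) \<le> C * (1 + cmod s) ^ N"
  shows "\<exists>B. \<forall>s. r \<le> Re s \<and> Re s \<le> b \<longrightarrow>
    cmod (L s * laplace u s * of_real a powr (1/2 - s)) \<le> B / (1 + (Im s)\<^sup>2)"
proof -
  obtain B where B: "\<And>s. r \<le> Re s \<and> Re s \<le> b \<Longrightarrow> cmod (laplace u s) * cmod s ^ (N + 2) \<le> B"
    using laplace_rapid_decay[OF u r] by metis
  define M where "M = exp ((1/2 - b) * ln a) + exp ((1/2 - r) * ln a)"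
  \<comment> \<open>One takes two more powers of \<open>s\<close> from the transform than the growth of \<open>L\<close> uses up. As \<open>\<bar>s\<bar> \<ge> 1/2\<close>,
    \<open>1 + \<bar>s\<bar> \<le> 3 \<bar>s\<bar>\<close>, which gives the power of 3.\<close>
  have "cmod (L s * laplace u s * of_real a powr (1/2 - s)) \<le> 4 * \<bar>C\<bar> * 3 ^ N * B * M / (1 + (Im s)\<^sup>2)"
    if s: "r \<le> Re s" "Re s \<le> b" for s
  proof -
    have half: "1/2 \<le> cmod s" using s r complex_Re_le_cmod[of s] by linarith
    have "cmod (L s) \<le> \<bar>C\<bar> * (1 + cmod s) ^ N"
      using L[OF s] by (rule order_trans) (intro mult_right_mono; simp)
    also have "\<dots> \<le> \<bar>C\<bar> * (3 * cmod s) ^ N"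
      using half by (intro mult_left_mono power_mono) auto
    finally have 1: "cmod (L s) \<le> \<bar>C\<bar> * 3 ^ N * cmod s ^ N"
      by (simp add: power_mult_distrib mult.assoc)
    have 2: "cmod (complex_of_real a powr (1/2 - s)) \<le> M"
      using exp_strip_le[of "1/2 - b" "1/2 - Re s" "1/2 - r" "ln a"] s a
      by (simp add: powr_def M_def Ln_of_real)
    have 3: "1 + (Im s)\<^sup>2 \<le> 4 * (cmod s)\<^sup>2"
      using one_plus_Im_square_le s r by simp
    have "cmod (L s) * cmod (laplace u s) * cmod (complex_of_real a powr (1/2 - s)) * (1 + (Im s)\<^sup>2)
       \<le> (\<bar>C\<bar> * 3 ^ N * cmod s ^ N) * cmod (laplace u s) * M * (4 * (cmod s)\<^sup>2)"
      by (intro mult_mono 1 2 3) (auto simp: M_def)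
    also have "\<dots> = 4 * \<bar>C\<bar> * 3 ^ N * (cmod (laplace u s) * cmod s ^ (N + 2)) * M"
      by (simp add: power_add power2_eq_square mult_ac)
    also have "\<dots> \<le> 4 * \<bar>C\<bar> * 3 ^ N * B * M"
      using B[of s] s by (intro mult_right_mono mult_left_mono) (auto simp: M_def)
    finally show ?thesis
      by (simp add: norm_mult pos_le_divide_eq add_pos_nonneg)
  qed
  then show ?thesis by blast
qed

section \<open>The matrix coefficient\<close>

lemma inv_transl_dil:
  assumes "a > 0"
  shows "inv\<^bsub>axb\<^esub> (transl T \<otimes>\<^bsub>axb\<^esub> dil a) = (1 / a, - T)"
  by (rule group.inv_equality[OF group_axb]) (use assms in \<open>auto simp: axb_def transl_def dil_def\<close>)

theorem theorem1p3:
  fixes d :: "nat \<Rightarrow> complex" and L :: "complex \<Rightarrow> complex"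
    and r \<epsilon> T a :: real and \<phi> :: "real \<Rightarrow> complex"
  assumes d_growth: "\<And>\<tau>::real. \<tau> > 0 \<Longrightarrow> \<exists>C::real. \<forall>n\<ge>1. cmod (d n) \<le> C * real n powr \<tau>"
    and r: "r > 1/2"
    and eps: "\<epsilon> > 0"
    and L_hol: "L_continued_to d L {s. r \<le> Re s \<and> Re s \<le> 1 + \<epsilon>}"
    and L_poly: "\<exists>(C::real) (N::nat). \<forall>s. r \<le> Re s \<and> Re s \<le> 1 + \<epsilon> \<longrightarrow>
                   cmod (L s) \<le> C * (1 + cmod s) ^ N"
    and phi: "\<phi> \<in> H_infty"
    and a: "a > 0"
  shows "let g = transl T \<otimes>\<^bsub>axb\<^esub> dil a;
             F = (\<lambda>s1::real.
                    L (Complex r s1)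
                  * mellin (\<lambda>x. \<phi> x * exp (- 2 * of_real pi * \<i> * of_real T * of_real x))
                      (Complex r s1)
                  * of_real a powr (1/2 - Complex r s1))
         in (\<lambda>n. d n * dirac (real n) (mu_star (inv\<^bsub>axb\<^esub> g) \<phi>)) summable_on {1..}
          \<and> integrable lborel F
          \<and> mu_coeff (delta_series d) \<phi> g = mu_distr g (delta_series d) \<phi>
          \<and> mu_distr g (delta_series d) \<phi> = 1 / (2 * of_real pi) * (LINT s1|lborel. F s1)"
proof -
  define \<psi> where "\<psi> = (\<lambda>x. \<phi> x * exp (- 2 * of_real pi * \<i> * of_real T * of_real x))"
  define u where "u = (\<lambda>y. \<psi> (exp y))"
  have u: "log_smooth u"
    unfolding u_def \<psi>_def by (rule H_infty_twist_log_smooth[OF phi])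
  have mellin: "mellin \<psi> s = laplace u s" for s
    using mellin_eq_laplace[of \<psi>] log_smooth_continuous[OF u] by (simp add: u_def)
  define g where "g = transl T \<otimes>\<^bsub>axb\<^esub> dil a"
  define f where "f s = L s * laplace u s * of_real a powr (1/2 - s)" for s
  have L_eq: "L s = dirichlet d s" if "Re s > 1" for s
    using L_hol that by (auto simp: L_continued_to_def)
  have coeff: "d n * dirac (real n) (mu_star (inv\<^bsub>axb\<^esub> g) \<phi>) = of_real (a powr (1/2)) * (d n * u (ln (a * real n)))"
    if "n \<in> {1..}" for n
  proof -
    have "a * real n > 0" using that a by simp
    moreover have "(1 / a) powr (- 1 / 2) = a powr (1/2)"
      using a by (simp add: powr_def ln_div)
    ultimately show ?thesis
      unfolding g_def inv_transl_dil[OF a] u_def \<psi>_def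
      by (simp add: dirac_def mu_star_def mu_star_dil_def mu_star_transl_def mult_ac)
  qed
  \<comment> \<open>A line in the half-plane of absolute convergence. If the strip is empty, it is the line of the claim
    itself, and there is nothing to shift.\<close>
  define \<sigma> where "\<sigma> = max r (1 + \<epsilon>)"
  have \<sigma>: "\<sigma> > 1" using eps by (simp add: \<sigma>_def)
  have f_line: "f (Complex \<sigma>' t) = dirichlet d (Complex \<sigma>' t) * laplace u (Complex \<sigma>' t) * of_real a powr (1/2 - Complex \<sigma>' t)"
    if "\<sigma>' > 1" for \<sigma>' t
    unfolding f_def using L_eq[of "Complex \<sigma>' t"] that by simp
  note pairing = dirichlet_laplace_pairing[OF u \<sigma> a d_growth, folded f_line[OF \<sigma>]]
  have shift: "integrable lborel (\<lambda>t. f (Complex r t)) \<and> (LINT t|lborel. f (Complex r t)) = (LINT t|lborel. f (Complex \<sigma> t))"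
  proof (cases "r \<le> 1 + \<epsilon>")
    case True
    obtain U where U: "open U" "{s. r \<le> Re s \<and> Re s \<le> 1 + \<epsilon>} \<subseteq> U" "L holomorphic_on U"
      using L_hol by (auto simp: L_continued_to_def)
    have diff: "f field_differentiable at s" if s: "r \<le> Re s" "Re s \<le> 1 + \<epsilon>" for s
    proof -
      have "L field_differentiable at s"
        using U s by (auto intro: holomorphic_on_imp_differentiable_at)
      moreover have "laplace u field_differentiable at s"
        using s r by (intro holomorphic_on_imp_differentiable_at[OF laplace_holomorphic[OF u] open_halfspace_Re_gt]) auto
      moreover have "(\<lambda>s. of_real a powr (1/2 - s)) field_differentiable at s"
      proof -
        have "((\<lambda>s. exp ((1/2 - s) * of_real (ln a))) has_field_derivative
            exp ((1/2 - s) * of_real (ln a)) * - of_real (ln a)) (at s)"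
          by (auto intro!: derivative_eq_intros)
        then show ?thesis
          using a by (auto simp: powr_def Ln_of_real field_differentiable_def)
      qed
      ultimately show ?thesis
        unfolding f_def by (intro field_differentiable_mult)
    qed
    obtain C N where "\<And>s. r \<le> Re s \<Longrightarrow> Re s \<le> 1 + \<epsilon> \<Longrightarrow> cmod (L s) \<le> C * (1 + cmod s) ^ N"
      using L_poly by blast
    from continued_L_laplace_decay[OF u r a this]
    obtain B where B: "\<And>s. r \<le> Re s \<Longrightarrow> Re s \<le> 1 + \<epsilon> \<Longrightarrow> cmod (f s) \<le> B / (1 + (Im s)\<^sup>2)"
      unfolding f_def by blast
    have "continuous_on {s. Re s = r} f"
      using diff True by (intro continuous_at_imp_continuous_on ballI field_differentiable_imp_continuous_at) auto
    then have "continuous_on UNIV (\<lambda>t. f (Complex r t))"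
      by (rule continuous_on_compose2) (auto simp: Complex_eq intro!: continuous_intros)
    then have "integrable lborel (\<lambda>t. f (Complex r t))"
      by (rule integrable_inverse_square_decay) (use B[of "Complex r t" for t] True in auto)
    moreover have "(LINT t|lborel. f (Complex r t)) = (LINT t|lborel. f (Complex (1 + \<epsilon>) t))"
      by (rule integral_vertical_line_shift[OF True diff B])
    ultimately show ?thesis using True by (simp add: \<sigma>_def max_absorb2)
  next
    case False
    then have "\<sigma> = r" by (simp add: \<sigma>_def)
    then show ?thesis using pairing(2) by simp
  qed
  have sum: "(\<lambda>n. d n * dirac (real n) (mu_star (inv\<^bsub>axb\<^esub> g) \<phi>)) summable_on {1..}"
    using summable_on_cmult_right[OF pairing(1)] by (subst summable_on_cong[OF coeff])
  have "mu_distr g (delta_series d) \<phi> = of_real (a powr (1/2)) * (\<Sum>\<^sub>\<infinity>n\<in>{1..}. d n * u (ln (a * real n)))"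
    unfolding mu_distr_def delta_series_def
    using infsum_cong[OF coeff] infsum_cmult_right[OF pairing(1)] by (rule trans)
  also have "\<dots> = 1 / (2 * of_real pi) * (LINT t|lborel. f (Complex r t))"
    using shift pairing(3) by simp
  finally show ?thesis
    using sum shift unfolding Let_def g_def[symmetric] \<psi>_def[symmetric] mellin
    by (simp add: mu_coeff_def f_def)
qed

end
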